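(* A function $f:\{-1,1\}^d\to\{-1,1\}$ is weakly representable by $\textsc{polythr}^k_d$ (that is, weakly represented by some nonzero real function on $\{-1,1\}^d$ given by a polynomial of degree at most $k$) if and only if $\beta_{i,\dagger}\big((\textsc{polythr}^k_d)^{\boxtimes f}\big)=0$ for all $i$.
   Context: $\textsc{polythr}^k_d$ is the set of functions $\{-1,1\}^d\to\{-1,1\}$ of the form $\operatorname{sgn}(p)$ with $p$ a real polynomial of degree at most $k$ not vanishing at any point of $\{-1,1\}^d$. A real function $\varphi$ on $\mathcal U=\{-1,1\}^d$ weakly represents $f$ if for every $u\in\mathcal U$ with $\varphi(u)\neq0$ one has $\operatorname{sgn}\varphi(u)=f(u)$ (nothing is required where $\varphi(u)=0$). For a class $\mathtt D$ of functions $\mathcal U\to\{-1,1\}$, $\mathtt D^{\boxtimes f}:=\{g\cap f: g\in\mathtt D\}$ is the class of partial functions, where $g\cap f$ is the partial function defined on the inputs where $g$ and $f$ agree, with the common value. Fix a field $\Bbbk$ and let $S=\Bbbk[x_{u,a}:u\in\mathcal U,\ a\in\{-1,1\}]$. For a partial function $\mathsf f$ let $\Gamma\mathsf f=(\mathcal U\times\{-1,1\})\setminus\operatorname{graph}\mathsf f$ and $\mathbf x^\sigma=\prod_{(u,a)\in\sigma}x_{u,a}$. For a class $\mathcal C$ of partial functions, $I^\star_{\mathcal C}=\langle\mathbf x^{\Gamma\mathsf f}:\mathsf f\in\mathcal C\rangle$ and $\beta_{i,\mathsf f}(\mathcal C)=\dim_\Bbbk\operatorname{Tor}^S_i(\Bbbk,I^\star_{\mathcal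 C})_{\Gamma\mathsf f}$ is the multigraded Betti number in degree $\Gamma\mathsf f$. $\dagger$ is the partial function with empty domain. *)

theory Defs
  imports Complex_Main "HOL-Library.Function_Algebras" "HOL-Library.Poly_Mapping"
begin

section \<open>Polynomials\<close>

text \<open>
  A monomial with indeterminates in \<open>'v\<close> is its exponent vector \<open>'v \<Rightarrow>\<^sub>0 nat\<close>; a polynomial is a
  finitely supported function from monomials to coefficients, with the convolution product of
  \<^theory>\<open>HOL-Library.Poly_Mapping\<close>. When \<open>'v\<close> is finite this is the ring \<open>\<bbbk>[x\<^sub>v : v \<in> 'v]\<close>.
\<close>

type_synonym ('v, 'k) mpoly = "('v \<Rightarrow>\<^sub>0 nat) \<Rightarrow>\<^sub>0 'k"

definition indet :: "'v \<Rightarrow> ('v, 'k::comm_ring_1) mpoly" where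
  "indet v = Poly_Mapping.single (Poly_Mapping.single v 1) 1"

definition poly_eval :: "('v::finite, 'k::comm_ring_1) mpoly \<Rightarrow> ('v \<Rightarrow> 'k) \<Rightarrow> 'k" where
  "poly_eval p x =
     (\<Sum>m \<in> Poly_Mapping.keys p.
        Poly_Mapping.lookup p m * (\<Prod>v\<in>UNIV. x v ^ Poly_Mapping.lookup m v))"

definition total_degree_le :: "nat \<Rightarrow> ('v::finite, 'k::zero) mpoly \<Rightarrow> bool" where
  "total_degree_le n p \<longleftrightarrow> (\<forall>m \<in> Poly_Mapping.keys p. (\<Sum>v\<in>UNIV. Poly_Mapping.lookup m v) \<le> n)"

definition ideal_gen :: "'r::comm_ring_1 set \<Rightarrow> 'r set" where
  "ideal_gen G = module.span (*) G"


section \<open>Boolean functions and polynomial thresholds\<close>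

datatype sign = Minus | Plus

instance sign :: finite
proof
  have "(UNIV :: sign set) = {Minus, Plus}" using sign.exhaust by auto
  then show "finite (UNIV :: sign set)" by (metis finite.emptyI finite_insert)
qed

fun sign_val :: "sign \<Rightarrow> real" where
  "sign_val Minus = -1"
| "sign_val Plus = 1"

text \<open>
  The cube \<open>{-1,1}\<^sup>d\<close>: a finite index type \<open>'d\<close> plays the role of the dimension \<open>d = CARD('d)\<close>.
\<close>

type_synonym 'd cube = "'d \<Rightarrow> sign"

definition cube_eval :: "('d::finite, real) mpoly \<Rightarrow> 'd cube \<Rightarrow> real" where
  "cube_eval p u = poly_eval p (\<lambda>i. sign_val (u i))"

definition polythr :: "nat \<Rightarrow> ('d::finite cube \<Rightarrow> sign) set" where
  "polythr k = {g. \<exists>p. total_degree_le k p \<and> (\<forall>u. cube_eval p u \<noteq> 0) \<and>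
                       (\<forall>u. sign_val (g u) = sgn (cube_eval p u))}"

definition weakly_represents :: "('u \<Rightarrow> real) \<Rightarrow> ('u \<Rightarrow> sign) \<Rightarrow> bool" where
  "weakly_represents \<phi> f \<longleftrightarrow> (\<forall>u. \<phi> u \<noteq> 0 \<longrightarrow> sgn (\<phi> u) = sign_val (f u))"

text \<open>Nonzero refers to the function on the cube, not to the polynomial inducing it.\<close>

definition weakly_representable_by_polythr :: "nat \<Rightarrow> ('d::finite cube \<Rightarrow> sign) \<Rightarrow> bool" where
  "weakly_representable_by_polythr k f \<longleftrightarrow>
     (\<exists>\<phi>. (\<exists>p. total_degree_le k p \<and> \<phi> = cube_eval p) \<and> \<phi> \<noteq> (\<lambda>u. 0) \<and> weakly_represents \<phi> f)"

definition agreement :: "('u \<Rightarrow> 'a) \<Rightarrow> ('u \<Rightarrow> 'a) \<Rightarrow> ('u \<rightharpoonup> 'a)" where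
  "agreement g f = (\<lambda>u. if g u = f u then Some (g u) else None)"

definition box_restrict :: "('u \<Rightarrow> 'a) set \<Rightarrow> ('u \<Rightarrow> 'a) \<Rightarrow> ('u \<rightharpoonup> 'a) set" where
  "box_restrict D f = {agreement g f | g. g \<in> D}"


section \<open>Multigraded Tor\<close>

text \<open>
  The free module \<open>R\<^sup>n\<close> consists of the sequences vanishing from index \<open>n\<close> on, and
  \<open>mat_apply m n A\<close> is the map \<open>R\<^sup>n \<rightarrow> R\<^sup>m\<close> given by the upper left \<open>m \<times> n\<close> block of \<open>A\<close>.
\<close>

definition free_mod :: "nat \<Rightarrow> (nat \<Rightarrow> 'r::comm_ring_1) set" where
  "free_mod n = {v. \<forall>j\<ge>n. v j = 0}"

definition mat_apply ::
    "nat \<Rightarrow> nat \<Rightarrow> (nat \<Rightarrow> nat \<Rightarrow> 'r::comm_ring_1) \<Rightarrow> (nat \<Rightarrow> 'r) \<Rightarrow> (nat \<Rightarrow> 'r)" where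
  "mat_apply m n A v = (\<lambda>r. if r < m then (\<Sum>c<n. A r c * v c) else 0)"

text \<open>
  Data of an augmented complex \<open>\<dots> \<rightarrow> F\<^sub>2 \<rightarrow> F\<^sub>1 \<rightarrow> F\<^sub>0 \<rightarrow> I\<close> of finitely generated free multigraded modules
  over the polynomial ring: \<open>F\<^sub>i\<close> has rank \<open>rk i\<close>, its \<open>j\<close>-th basis vector has degree \<open>gdeg i j\<close>,
  \<open>diff i\<close> is the matrix of \<open>F\<^bsub>i+1\<^esub> \<rightarrow> F\<^sub>i\<close>, and \<open>aug j\<close> is the image of the \<open>j\<close>-th basis
  vector of \<open>F\<^sub>0\<close>.
\<close>

record (overloaded) ('v, 'k) graded_complex =
  rk :: "nat \<Rightarrow> nat"
  gdeg :: "nat \<Rightarrow> nat \<Rightarrow> ('v \<Rightarrow>\<^sub>0 nat)"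
  diff :: "nat \<Rightarrow> nat \<Rightarrow> nat \<Rightarrow> ('v, 'k) mpoly"
  aug :: "nat \<Rightarrow> ('v, 'k) mpoly"

definition boundary ::
    "('v, 'k::comm_ring_1) graded_complex \<Rightarrow> nat \<Rightarrow> (nat \<Rightarrow> ('v, 'k) mpoly) \<Rightarrow> (nat \<Rightarrow> ('v, 'k) mpoly)"
  where "boundary F i = mat_apply (rk F i) (rk F (Suc i)) (diff F i)"

definition augmentation ::
    "('v, 'k::comm_ring_1) graded_complex \<Rightarrow> (nat \<Rightarrow> ('v, 'k) mpoly) \<Rightarrow> ('v, 'k) mpoly"
  where "augmentation F v = (\<Sum>c<rk F 0. aug F c * v c)"

text \<open>
  The maps preserve multidegree: every monomial \<open>m\<close> of the \<open>(r,c)\<close> entry of \<open>diff F i\<close> satisfies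
  \<open>m + gdeg F i r = gdeg F (i+1) c\<close>, so an entry is zero unless this equation is solvable in \<open>m\<close>.
\<close>

definition homogeneous_maps :: "('v, 'k::comm_ring_1) graded_complex \<Rightarrow> bool" where
  "homogeneous_maps F \<longleftrightarrow>
     (\<forall>i. \<forall>r<rk F i. \<forall>c<rk F (Suc i). \<forall>m \<in> Poly_Mapping.keys (diff F i r c).
        m + gdeg F i r = gdeg F (Suc i) c) \<and>
     (\<forall>c<rk F 0. \<forall>m \<in> Poly_Mapping.keys (aug F c). m = gdeg F 0 c)"

definition graded_free_resolution ::
    "('v, 'k::comm_ring_1) graded_complex \<Rightarrow> ('v, 'k) mpoly set \<Rightarrow> bool" where
  "graded_free_resolution F I \<longleftrightarrow>
     homogeneous_maps F \<and>
     augmentation F ` free_mod (rk F 0) = I \<and>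
     {v \<in> free_mod (rk F 0). augmentation F v = 0} = boundary F 0 ` free_mod (rk F 1) \<and>
     (\<forall>i. {v \<in> free_mod (rk F (Suc i)). boundary F i v = (\<lambda>_. 0)} =
            boundary F (Suc i) ` free_mod (rk F (Suc (Suc i))))"

text \<open>
  Here \<open>\<bbbk>\<close> is the quotient of the polynomial ring by the ideal of all indeterminates. Hence
  \<open>\<bbbk> \<otimes> F\<^sub>i\<close> is \<open>\<bbbk>\<close> to the power \<open>rk F i\<close>, with basis vectors in the degrees \<open>gdeg F i j\<close>, and its
  differential is obtained by reducing the entries of \<open>diff F i\<close> to their constant coefficients.
  The complex being tensored is \<open>\<dots> \<rightarrow> F\<^sub>1 \<rightarrow> F\<^sub>0 \<rightarrow> 0\<close>, without the augmentation, so in homological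
  degree \<open>0\<close> every element is a cycle.
\<close>

definition reduced_part ::
    "('v, 'k::field) graded_complex \<Rightarrow> nat \<Rightarrow> ('v \<Rightarrow>\<^sub>0 nat) \<Rightarrow> (nat \<Rightarrow> 'k) set" where
  "reduced_part F i \<sigma> = {v \<in> free_mod (rk F i). \<forall>j<rk F i. v j \<noteq> 0 \<longrightarrow> gdeg F i j = \<sigma>}"

definition reduced_boundary ::
    "('v, 'k::field) graded_complex \<Rightarrow> nat \<Rightarrow> (nat \<Rightarrow> 'k) \<Rightarrow> (nat \<Rightarrow> 'k)" where
  "reduced_boundary F i =
     mat_apply (rk F i) (rk F (Suc i)) (\<lambda>r c. Poly_Mapping.lookup (diff F i r c) 0)"

definition cycles ::
    "('v, 'k::field) graded_complex \<Rightarrow> nat \<Rightarrow> ('v \<Rightarrow>\<^sub>0 nat) \<Rightarrow> (nat \<Rightarrow> 'k) set" where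
  "cycles F i \<sigma> =
     {v \<in> reduced_part F i \<sigma>. \<forall>i'. i = Suc i' \<longrightarrow> reduced_boundary F i' v = (\<lambda>_. 0)}"

definition boundaries ::
    "('v, 'k::field) graded_complex \<Rightarrow> nat \<Rightarrow> ('v \<Rightarrow>\<^sub>0 nat) \<Rightarrow> (nat \<Rightarrow> 'k) set" where
  "boundaries F i \<sigma> = reduced_boundary F i ` reduced_part F (Suc i) \<sigma>"

abbreviation kdim :: "(nat \<Rightarrow> 'k::field) set \<Rightarrow> nat" where
  "kdim V \<equiv> vector_space.dim (\<lambda>a v j. a * v j) V"

text \<open>
  The dimension of the quotient of cycles by boundaries; all ranks are finite, so both spaces are
  finite-dimensional.
\<close>

definition homology_dim :: "('v, 'k::field) graded_complex \<Rightarrow> nat \<Rightarrow> ('v \<Rightarrow>\<^sub>0 nat) \<Rightarrow> nat" where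
  "homology_dim F i \<sigma> = kdim (cycles F i \<sigma>) - kdim (boundaries F i \<sigma>)"

text \<open>
  The dimension of the degree \<open>\<sigma>\<close> part of \<open>Tor\<^sub>i(\<bbbk>, I)\<close> for a monomial ideal \<open>I\<close> in finitely many
  indeterminates. Such an ideal has a multigraded free resolution of finite ranks, and any two have
  the same homology after tensoring with \<open>\<bbbk>\<close>, so the choice of the resolution is immaterial.
\<close>

definition tor_dim :: "nat \<Rightarrow> ('v, 'k::field) mpoly set \<Rightarrow> ('v \<Rightarrow>\<^sub>0 nat) \<Rightarrow> nat" where
  "tor_dim i I \<sigma> = homology_dim (SOME F. graded_free_resolution F I) i \<sigma>"


section \<open>Betti numbers of a class of partial functions\<close>

definition graph_compl :: "('u \<rightharpoonup> 'a) \<Rightarrow> ('u \<times> 'a) set" where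
  "graph_compl h = UNIV - Map.graph h"

definition sqfree_monom :: "'v set \<Rightarrow> ('v, 'k::comm_ring_1) mpoly" where
  "sqfree_monom s = (\<Prod>v\<in>s. indet v)"

definition sqfree_degree :: "'v set \<Rightarrow> ('v \<Rightarrow>\<^sub>0 nat)" where
  "sqfree_degree s = (\<Sum>v\<in>s. Poly_Mapping.single v 1)"

definition canonical_ideal ::
    "('u \<rightharpoonup> 'a) set \<Rightarrow> ('u \<times> 'a, 'k::comm_ring_1) mpoly set" where
  "canonical_ideal C = ideal_gen {sqfree_monom (graph_compl h) | h. h \<in> C}"

text \<open>The type argument names the ground field.\<close>

definition betti ::
    "'k::field itself \<Rightarrow> nat \<Rightarrow> ('u::finite \<rightharpoonup> 'a::finite) \<Rightarrow> ('u \<rightharpoonup> 'a) set \<Rightarrow> nat" where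
  "betti _ i h C =
     tor_dim i (canonical_ideal C :: ('u \<times> 'a, 'k) mpoly set) (sqfree_degree (graph_compl h))"

end

theory Submission
  imports Defs
begin

text \<open>
  Let \<open>W\<close> be the space of functions \<open>f \<cdot> p\<close> on the cube, with \<open>p\<close> a polynomial of degree at most \<open>k\<close>. A set
  of points of the cube is contained in the domain of a member of the class iff some \<open>\<phi> \<in> W\<close> is positive on
  it. So these sets form a simplicial complex \<open>K\<close>, the nerve of the open half-spaces \<open>\<phi> u > 0\<close> of \<open>W\<close>, and
  \<open>f\<close> is weakly representable iff \<open>W\<close> contains a nonzero \<open>\<phi> \<ge> 0\<close>. If there is such a \<open>\<phi>\<close>, then
  \<open>K\<close> is a cone over every \<open>v\<close> with \<open>\<phi> v > 0\<close>, because large multiples of \<open>\<phi>\<close> can be added to any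
  element of \<open>W\<close>. If there is none, the half-spaces cover \<open>W\<close> without the origin, and \<open>K\<close> has the homotopy
  type of a sphere. The Betti numbers in question are the dimensions of the reduced homology of \<open>K\<close>, so they
  vanish exactly in the first case.

  Two weak forms of the last sentence suffice: the Betti numbers vanish if \<open>K\<close> is a cone
  (\<open>betti_vanish_if_cone\<close>), and if they vanish then so does the Euler characteristic of \<open>K\<close>
  (\<open>euler_eq_0_if_betti_vanish\<close>). That the Euler characteristic of the sphere is not zero is proved for
  hyperplane arrangements by removing one half-space at a time (\<open>euler_covered\<close>,
  \<open>euler_uncovered_origin\<close>).

  For the algebra, setting all indeterminates of a multigraded resolution to one gives a complex of vector
  spaces filtered by the degrees of the basis vectors, and exactness of the resolution means exactness of
  every piece of the filtration (\<open>exact_iff_exact_in_degrees\<close>). The complex computing the Betti numbers in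
  the degree of all indeterminates is the quotient of the piece below that degree by the pieces below its
  proper divisors. It is reached by dividing out one indeterminate at a time, and each step is a short exact
  sequence of complexes. Exactness and Euler characteristics are followed along these sequences; since a
  resolution may be infinite, the Euler characteristics are truncated in a degree above which all complexes
  are exact. This treats every resolution alike, so no comparison of resolutions occurs. It remains
  to see that there is one (\<open>graded_free_resolution_exists\<close>): the syzygies in degree \<open>\<rho>\<close> depend only on
  which of the finitely many basis vectors have a degree dividing \<open>\<rho>\<close>.
\<close>

section \<open>Euler characteristics of hyperplane arrangements\<close>

text \<open>
  The simplicial complexes below are nerves of families of half-spaces: a set of indices is a face
  iff the half-spaces \<open>\<phi> v > 0\<close> for its members meet inside \<open>E\<close>.
\<close>

definition positive_sets :: "('u \<Rightarrow> real) set \<Rightarrow> 'u set \<Rightarrow> 'u set set" where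
  "positive_sets E U = {\<tau>. \<tau> \<subseteq> U \<and> (\<exists>\<phi>\<in>E. \<forall>u\<in>\<tau>. \<phi> u > 0)}"

lemma positive_setsI: "\<tau> \<subseteq> U \<Longrightarrow> \<phi> \<in> E \<Longrightarrow> \<forall>u\<in>\<tau>. \<phi> u > 0 \<Longrightarrow> \<tau> \<in> positive_sets E U"
  by (auto simp: positive_sets_def)

text \<open>
  The empty face counts with sign \<open>+1\<close>, so this is the reduced Euler characteristic up to sign. In
  particular it vanishes for a cone and is \<open>\<plusminus> 1\<close> for a sphere and for the complex \<open>{{}}\<close>.
\<close>

definition euler :: "'u set set \<Rightarrow> int" where
  "euler K = (\<Sum>\<tau>\<in>K. (-1) ^ card \<tau>)"

text \<open>
  Relative openness is taken along lines: from any point of \<open>E\<close> one can move a little towards and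
  away from any other point. Unlike openness in a subspace, this form is inherited by the sections of
  \<open>E\<close> with \<open>\<phi> u > 0\<close>, \<open>\<phi> u < 0\<close> and \<open>\<phi> u = 0\<close> alike.
\<close>

definition open_convex :: "('u \<Rightarrow> real) set \<Rightarrow> bool" where
  "open_convex E \<longleftrightarrow>
     (\<forall>\<phi>\<in>E. \<forall>\<psi>\<in>E. \<forall>t. 0 \<le> t \<longrightarrow> t \<le> 1 \<longrightarrow> (\<lambda>u. \<phi> u + t * (\<psi> u - \<phi> u)) \<in> E) \<and>
     (\<forall>\<phi>\<in>E. \<forall>\<psi>\<in>E. \<exists>\<epsilon>>0. \<forall>t. \<bar>t\<bar> < \<epsilon> \<longrightarrow> (\<lambda>u. \<phi> u + t * (\<psi> u - \<phi> u)) \<in> E)"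

lemma open_convexD:
  assumes "open_convex E" "\<phi> \<in> E" "\<psi> \<in> E"
  shows "0 \<le> t \<Longrightarrow> t \<le> 1 \<Longrightarrow> (\<lambda>u. \<phi> u + t * (\<psi> u - \<phi> u)) \<in> E"
    and "\<exists>\<epsilon>>0. \<forall>t. \<bar>t\<bar> < \<epsilon> \<longrightarrow> (\<lambda>u. \<phi> u + t * (\<psi> u - \<phi> u)) \<in> E"
  using assms unfolding open_convex_def by blast+

lemma small_step_positive:
  fixes a b :: real
  assumes "a > 0"
  shows "\<exists>\<epsilon>>0. \<forall>t. \<bar>t\<bar> < \<epsilon> \<longrightarrow> a + t * b > 0"
proof (intro exI[of _ "a / (\<bar>b\<bar> + 1)"] conjI allI impI)
  show "0 < a / (\<bar>b\<bar> + 1)" using assms by (simp add: add_nonneg_pos)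
  fix t assume "\<bar>t\<bar> < a / (\<bar>b\<bar> + 1)"
  then have "\<bar>t\<bar> * (\<bar>b\<bar> + 1) < a" by (simp add: pos_less_divide_eq add_nonneg_pos)
  then have "\<bar>t * b\<bar> + \<bar>t\<bar> < a" by (simp add: abs_mult algebra_simps)
  then show "a + t * b > 0" by linarith
qed

lemma small_step_positive_on:
  fixes \<phi> \<psi> :: "'u \<Rightarrow> real"
  assumes "finite \<tau>" "\<forall>u\<in>\<tau>. \<phi> u > 0"
  shows "\<exists>\<epsilon>>0. \<forall>t. \<bar>t\<bar> < \<epsilon> \<longrightarrow> (\<forall>u\<in>\<tau>. \<phi> u + t * \<psi> u > 0)"
  using assms
proof (induction \<tau> rule: finite_induct)
  case empty
  show ?case by (intro exI[of _ 1]) auto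
next
  case (insert u \<tau>)
  then obtain e1 where "e1 > 0" "\<forall>t. \<bar>t\<bar> < e1 \<longrightarrow> (\<forall>u\<in>\<tau>. \<phi> u + t * \<psi> u > 0)" by auto
  moreover obtain e2 where "e2 > 0" "\<forall>t. \<bar>t\<bar> < e2 \<longrightarrow> \<phi> u + t * \<psi> u > 0"
    using small_step_positive[of "\<phi> u" "\<psi> u"] insert.prems by auto
  ultimately show ?case by (intro exI[of _ "min e1 e2"]) auto
qed

lemma open_convex_section:
  assumes E: "open_convex E"
  shows "open_convex {\<phi>\<in>E. \<phi> u > 0}" "open_convex {\<phi>\<in>E. \<phi> u < 0}" "open_convex {\<phi>\<in>E. \<phi> u = 0}"
proof -
  have half: "open_convex {\<phi>\<in>E. s * \<phi> u > 0}" for s :: real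
    unfolding open_convex_def
  proof (intro conjI ballI allI impI)
    fix \<phi> \<psi> and t :: real
    assume \<phi>: "\<phi> \<in> {\<phi>\<in>E. s * \<phi> u > 0}" and \<psi>: "\<psi> \<in> {\<phi>\<in>E. s * \<phi> u > 0}" and t: "0 \<le> t" "t \<le> 1"
    have "s * (\<phi> u + t * (\<psi> u - \<phi> u)) = (1 - t) * (s * \<phi> u) + t * (s * \<psi> u)"
      by (simp add: algebra_simps)
    also have "\<dots> > 0"
    proof (cases "t = 0")
      case False
      then have "t * (s * \<psi> u) > 0" using \<psi> t by simp
      moreover have "(1 - t) * (s * \<phi> u) \<ge> 0" using \<phi> t by simp
      ultimately show ?thesis by linarith
    qed (use \<phi> in simp)
    finally show "(\<lambda>w. \<phi> w + t * (\<psi> w - \<phi> w)) \<in> {\<phi>\<in>E. s * \<phi> u > 0}"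
      using open_convexD(1)[OF E] \<phi> \<psi> t by simp
  next
    fix \<phi> \<psi>
    assume \<phi>: "\<phi> \<in> {\<phi>\<in>E. s * \<phi> u > 0}" and \<psi>: "\<psi> \<in> {\<phi>\<in>E. s * \<phi> u > 0}"
    obtain e1 where e1: "e1 > 0" "\<forall>t. \<bar>t\<bar> < e1 \<longrightarrow> (\<lambda>u. \<phi> u + t * (\<psi> u - \<phi> u)) \<in> E"
      using open_convexD(2)[OF E] \<phi> \<psi> by blast
    obtain e2 where e2: "e2 > 0" "\<forall>t. \<bar>t\<bar> < e2 \<longrightarrow> s * \<phi> u + t * (s * (\<psi> u - \<phi> u)) > 0"
      using small_step_positive[of "s * \<phi> u"] \<phi> by blast
    have "s * (\<phi> u + t * (\<psi> u - \<phi> u)) > 0" if "\<bar>t\<bar> < e2" for t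
      using e2(2)[rule_format, OF that] by (simp add: algebra_simps)
    then show "\<exists>\<epsilon>>0. \<forall>t. \<bar>t\<bar> < \<epsilon> \<longrightarrow> (\<lambda>w. \<phi> w + t * (\<psi> w - \<phi> w)) \<in> {\<phi>\<in>E. s * \<phi> u > 0}"
      using e1 e2(1) by (intro exI[of _ "min e1 e2"]) auto
  qed
  show "open_convex {\<phi>\<in>E. \<phi> u > 0}" using half[of 1] by simp
  show "open_convex {\<phi>\<in>E. \<phi> u < 0}" using half[of "-1"] by simp
  show "open_convex {\<phi>\<in>E. \<phi> u = 0}"
    using E unfolding open_convex_def by simp
qed

lemma finite_positive_sets: "finite U \<Longrightarrow> finite (positive_sets E U)"
  by (rule finite_subset[of _ "Pow U"]) (auto simp: positive_sets_def)

text \<open>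
  Deletion and link of the vertex \<open>u\<close>: the link consists of the faces that can be realised in \<open>E\<close>
  together with \<open>\<phi> u > 0\<close>, so it is again a complex of the same kind.
\<close>

lemma euler_insert:
  assumes "finite U" "u \<notin> U"
  shows "euler (positive_sets E (insert u U)) =
           euler (positive_sets E U) - euler (positive_sets {\<phi>\<in>E. \<phi> u > 0} U)"
proof -
  let ?A = "positive_sets {\<phi>\<in>E. \<phi> u > 0} U"
  have split: "positive_sets E (insert u U) = positive_sets E U \<union> insert u ` ?A"
  proof (intro equalityI subsetI)
    fix \<tau> assume \<tau>: "\<tau> \<in> positive_sets E (insert u U)"
    show "\<tau> \<in> positive_sets E U \<union> insert u ` ?A"
    proof (cases "u \<in> \<tau>")
      case True
      then have "\<tau> = insert u (\<tau> - {u})" by auto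
      moreover have "\<tau> - {u} \<in> ?A" using True \<tau> by (auto simp: positive_sets_def)
      ultimately show ?thesis by blast
    qed (use \<tau> in \<open>auto simp: positive_sets_def\<close>)
  qed (auto simp: positive_sets_def)
  have inj: "inj_on (insert u) ?A"
    using assms(2) unfolding inj_on_def positive_sets_def by (auto simp: insert_ident subset_iff)
  have card: "card (insert u \<tau>) = Suc (card \<tau>)" if "\<tau> \<in> ?A" for \<tau>
    using that assms by (subst card_insert_disjoint) (auto simp: positive_sets_def finite_subset)
  have "euler (positive_sets E (insert u U)) =
          euler (positive_sets E U) + (\<Sum>\<tau>\<in>insert u ` ?A. (-1) ^ card \<tau>)"
    unfolding euler_def split
    using assms by (intro sum.union_disjoint) (auto simp: finite_positive_sets positive_sets_def)
  also have "(\<Sum>\<tau>\<in>insert u ` ?A. (-1 :: int) ^ card \<tau>) = - euler ?A"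
    by (simp add: sum.reindex[OF inj] euler_def card sum_negf)
  finally show ?thesis by simp
qed

text \<open>
  A face of \<open>E\<close> is realised with \<open>\<phi> u \<noteq> 0\<close> after a small move towards a point off the hyperplane
  \<open>\<phi> u = 0\<close>, and it is realised on both sides of the hyperplane iff it is realised on it.
\<close>

lemma euler_hyperplane_split:
  assumes E: "open_convex E" and U: "finite U"
    and pos: "\<psi> \<in> E" "\<psi> u > 0" and neg: "\<xi> \<in> E" "\<xi> u < 0"
  shows "euler (positive_sets E U) =
           euler (positive_sets {\<phi>\<in>E. \<phi> u > 0} U) + euler (positive_sets {\<phi>\<in>E. \<phi> u < 0} U) -
           euler (positive_sets {\<phi>\<in>E. \<phi> u = 0} U)"
proof -
  let ?A = "positive_sets {\<phi>\<in>E. \<phi> u > 0} U" and ?B = "positive_sets {\<phi>\<in>E. \<phi> u < 0} U"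
  let ?Z = "positive_sets {\<phi>\<in>E. \<phi> u = 0} U"
  \<comment> \<open>moving slightly off the hyperplane, to a chosen side\<close>
  have push: "\<exists>t>0. (\<lambda>w. \<phi> w + t * (\<chi> w - \<phi> w)) \<in> E \<and> (\<forall>w\<in>\<tau>. \<phi> w + t * (\<chi> w - \<phi> w) > 0)"
    if \<phi>\<chi>: "\<phi> \<in> E" "\<chi> \<in> E" and \<tau>: "\<forall>w\<in>\<tau>. \<phi> w > 0" "\<tau> \<subseteq> U" for \<phi> \<chi> \<tau>
  proof -
    obtain e1 where e1: "e1 > 0" "\<forall>t. \<bar>t\<bar> < e1 \<longrightarrow> (\<lambda>u. \<phi> u + t * (\<chi> u - \<phi> u)) \<in> E"
      using open_convexD(2)[OF E \<phi>\<chi>] by blast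
    obtain e2 where e2: "e2 > 0" "\<forall>t. \<bar>t\<bar> < e2 \<longrightarrow> (\<forall>w\<in>\<tau>. \<phi> w + t * (\<chi> w - \<phi> w) > 0)"
      using small_step_positive_on[OF finite_subset[OF \<tau>(2) U] \<tau>(1), of "\<lambda>w. \<chi> w - \<phi> w"] by blast
    define t where "t = min e1 e2 / 2"
    have "t > 0" "\<bar>t\<bar> < e1" "\<bar>t\<bar> < e2" using e1(1) e2(1) by (auto simp: t_def min_def)
    then show ?thesis using e1(2) e2(2) by blast
  qed
  have "positive_sets E U = ?A \<union> ?B"
  proof (intro equalityI subsetI)
    fix \<tau> assume "\<tau> \<in> positive_sets E U"
    then obtain \<phi> where \<phi>: "\<tau> \<subseteq> U" "\<phi> \<in> E" "\<forall>w\<in>\<tau>. \<phi> w > 0" by (auto simp: positive_sets_def)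
    consider "\<phi> u > 0" | "\<phi> u < 0" | "\<phi> u = 0" by linarith
    then show "\<tau> \<in> ?A \<union> ?B"
    proof cases
      case 3
      obtain t where t: "t > 0" "(\<lambda>w. \<phi> w + t * (\<psi> w - \<phi> w)) \<in> E"
          "\<forall>w\<in>\<tau>. \<phi> w + t * (\<psi> w - \<phi> w) > 0"
        using push[OF \<phi>(2) pos(1) \<phi>(3,1)] by blast
      then have "(\<lambda>w. \<phi> w + t * (\<psi> w - \<phi> w)) \<in> {\<phi>\<in>E. \<phi> u > 0}" using 3 pos by simp
      then have "\<tau> \<in> ?A" by (rule positive_setsI[OF \<phi>(1) _ t(3)])
      then show ?thesis ..
    qed (use \<phi> in \<open>auto simp: positive_sets_def\<close>)
  qed (auto simp: positive_sets_def)
  moreover have "?A \<inter> ?B = ?Z"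
  proof (intro equalityI subsetI)
    fix \<tau> assume "\<tau> \<in> ?A \<inter> ?B"
    then obtain \<phi> \<chi> where *: "\<tau> \<subseteq> U" "\<phi> \<in> E" "\<chi> \<in> E" "\<phi> u > 0" "\<chi> u < 0"
        "\<forall>w\<in>\<tau>. \<phi> w > 0" "\<forall>w\<in>\<tau>. \<chi> w > 0"
      by (auto simp: positive_sets_def)
    define t where "t = \<phi> u / (\<phi> u - \<chi> u)"
    have t: "0 < t" "t < 1" using * by (auto simp: t_def field_simps)
    have "\<phi> u + t * (\<chi> u - \<phi> u) = 0"
      using * by (simp add: t_def field_simps)
    moreover have "\<phi> w + t * (\<chi> w - \<phi> w) > 0" if "w \<in> \<tau>" for w
    proof -
      have "(1 - t) * \<phi> w + t * \<chi> w > 0" using t * that by (intro add_pos_pos) auto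
      then show ?thesis by (simp add: algebra_simps)
    qed
    moreover have "(\<lambda>w. \<phi> w + t * (\<chi> w - \<phi> w)) \<in> E"
      using open_convexD(1)[OF E *(2,3)] t by simp
    ultimately show "\<tau> \<in> ?Z"
      by (intro positive_setsI[OF *(1), of "\<lambda>w. \<phi> w + t * (\<chi> w - \<phi> w)"]) auto
  next
    fix \<tau> assume "\<tau> \<in> ?Z"
    then obtain \<phi> where \<phi>: "\<tau> \<subseteq> U" "\<phi> \<in> E" "\<phi> u = 0" "\<forall>w\<in>\<tau>. \<phi> w > 0"
      by (auto simp: positive_sets_def)
    obtain t where t: "t > 0" "(\<lambda>w. \<phi> w + t * (\<psi> w - \<phi> w)) \<in> E"
        "\<forall>w\<in>\<tau>. \<phi> w + t * (\<psi> w - \<phi> w) > 0"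
      using push[OF \<phi>(2) pos(1) \<phi>(4,1)] by blast
    obtain s where s: "s > 0" "(\<lambda>w. \<phi> w + s * (\<xi> w - \<phi> w)) \<in> E"
        "\<forall>w\<in>\<tau>. \<phi> w + s * (\<xi> w - \<phi> w) > 0"
      using push[OF \<phi>(2) neg(1) \<phi>(4,1)] by blast
    have "(\<lambda>w. \<phi> w + t * (\<psi> w - \<phi> w)) \<in> {\<phi>\<in>E. \<phi> u > 0}"
      "(\<lambda>w. \<phi> w + s * (\<xi> w - \<phi> w)) \<in> {\<phi>\<in>E. \<phi> u < 0}"
      using \<phi> t s pos neg by (auto simp: mult_pos_neg)
    then show "\<tau> \<in> ?A \<inter> ?B"
      by (intro IntI positive_setsI[OF \<phi>(1) _ t(3)] positive_setsI[OF \<phi>(1) _ s(3)])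
  qed
  ultimately show ?thesis
    using sum.union_inter[of ?A ?B "\<lambda>\<tau>. (-1 :: int) ^ card \<tau>"] finite_positive_sets[OF U]
    unfolding euler_def by simp
qed

lemma euler_no_points: "euler (positive_sets {} U) = 0"
  by (simp add: euler_def positive_sets_def)

text \<open>
  Starting at a zero of the coordinate \<open>u\<close>, a small move away from \<open>\<psi>\<close> produces the sign opposite to
  that of \<open>\<psi> u\<close>.
\<close>

lemma open_convex_zero_sign:
  assumes E: "open_convex E" and "\<phi> \<in> E" "\<phi> u = 0" "\<psi> \<in> E" "\<psi> u \<noteq> 0"
  shows "\<exists>\<xi>\<in>E. \<xi> u * \<psi> u < 0"
proof -
  obtain e where e: "e > 0" "\<forall>t. \<bar>t\<bar> < e \<longrightarrow> (\<lambda>u. \<phi> u + t * (\<psi> u - \<phi> u)) \<in> E"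
    using open_convexD(2)[OF E assms(2,4)] by blast
  have "\<bar>- (e/2)\<bar> < e" using e(1) by simp
  with e(2) have "(\<lambda>w. \<phi> w + (- (e/2)) * (\<psi> w - \<phi> w)) \<in> E" by blast
  moreover have "(\<phi> u + (- (e/2)) * (\<psi> u - \<phi> u)) * \<psi> u = - (e/2) * (\<psi> u)\<^sup>2"
    by (simp add: assms(3) power2_eq_square)
  moreover have "- (e/2) * (\<psi> u)\<^sup>2 < 0" using e(1) assms(5) by (simp add: mult_neg_pos)
  ultimately show ?thesis by (metis (no_types, lifting))
qed

text \<open>
  When the half-spaces cover the convex set \<open>E\<close>, their nerve has the homotopy type of \<open>E\<close>, which is
  contractible. The induction removes one half-space: the difference of deletion and link equals the
  difference of the complexes on the negative side and on the hyperplane, and both of these sections of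
  \<open>E\<close> are still covered by the remaining half-spaces.
\<close>

lemma euler_covered:
  assumes "finite U" "open_convex E" "E \<noteq> {}" "\<forall>\<phi>\<in>E. \<exists>u\<in>U. \<phi> u > 0"
  shows "euler (positive_sets E U) = 0"
  using assms
proof (induction U arbitrary: E rule: finite_induct)
  case (insert u U)
  let ?P = "{\<phi>\<in>E. \<phi> u > 0}" and ?N = "{\<phi>\<in>E. \<phi> u < 0}" and ?Z = "{\<phi>\<in>E. \<phi> u = 0}"
  note step = euler_insert[OF insert.hyps(1,2), of E]
  note secs = open_convex_section[OF insert.prems(1), of u]
  show ?case
  proof (cases "?P = {}")
    case True
    then have "euler (positive_sets E U) = 0"
      using insert.prems by (intro insert.IH) auto
    then show ?thesis unfolding step True by (simp add: euler_no_points)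
  next
    case P: False
    then obtain \<psi> where \<psi>: "\<psi> \<in> E" "\<psi> u > 0" by auto
    show ?thesis
    proof (cases "?N = {}")
      case True
      have "?P = E"
      proof (intro equalityI subsetI)
        fix \<phi> assume \<phi>: "\<phi> \<in> E"
        have "\<not> \<xi> u < 0" if "\<xi> \<in> E" for \<xi> using True that by blast
        then have "\<phi> u \<noteq> 0"
          using open_convex_zero_sign[OF insert.prems(1) \<phi> _ \<psi>(1), of u] \<psi>(2)
          by (auto simp: mult_less_0_iff)
        then show "\<phi> \<in> ?P" using \<phi> True by force
      qed auto
      then show ?thesis unfolding step by simp
    next
      case False
      then obtain \<xi> where \<xi>: "\<xi> \<in> E" "\<xi> u < 0" by auto
      \<comment> \<open>the segment from \<open>\<psi>\<close> to \<open>\<xi>\<close> crosses the hyperplane\<close>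
      have "?Z \<noteq> {}"
      proof -
        define t where "t = \<psi> u / (\<psi> u - \<xi> u)"
        have t: "0 \<le> t" "t \<le> 1" using \<psi> \<xi> by (auto simp: t_def field_simps)
        have "\<psi> u + t * (\<xi> u - \<psi> u) = 0" using \<psi> \<xi> by (simp add: t_def field_simps)
        then show ?thesis using open_convexD(1)[OF insert.prems(1) \<psi>(1) \<xi>(1) t] by blast
      qed
      then have "euler (positive_sets ?Z U) = 0"
        using insert.prems secs by (intro insert.IH) auto
      moreover have "euler (positive_sets ?N U) = 0"
        using insert.prems secs False by (intro insert.IH) auto
      ultimately show ?thesis
        unfolding step euler_hyperplane_split[OF insert.prems(1) insert.hyps(1) \<psi> \<xi>] by simp
    qed
  qed
qed auto

text \<open>
  Here the half-spaces cover \<open>E\<close> without the origin, which has the homotopy type of a sphere. Removing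
  one half-space leads to the hyperplane \<open>\<phi> u = 0\<close>, that is, to a sphere of one dimension less; the
  negative side contributes nothing by the preceding lemma, because it does not contain the origin.
\<close>

lemma euler_uncovered_origin:
  assumes "finite U" "open_convex E" "(\<lambda>_. 0) \<in> E"
    "\<forall>\<phi>\<in>E. (\<forall>u\<in>U. \<phi> u \<le> 0) \<longrightarrow> \<phi> = (\<lambda>_. 0)"
  shows "\<bar>euler (positive_sets E U)\<bar> = 1"
  using assms
proof (induction U arbitrary: E rule: finite_induct)
  case empty
  then have "positive_sets E {} = {{}}" 
    by (intro equalityI subsetI) (auto intro: positive_setsI simp: positive_sets_def)
  then show ?case by (simp add: euler_def)
next
  case (insert u U)
  let ?P = "{\<phi>\<in>E. \<phi> u > 0}" and ?N = "{\<phi>\<in>E. \<phi> u < 0}" and ?Z = "{\<phi>\<in>E. \<phi> u = 0}"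
  note step = euler_insert[OF insert.hyps(1,2), of E]
  note secs = open_convex_section[OF insert.prems(1), of u]
  have Z: "\<bar>euler (positive_sets ?Z U)\<bar> = 1"
  proof (rule insert.IH)
    show "open_convex ?Z" by (rule secs)
    show "(\<lambda>_. 0) \<in> ?Z" using insert.prems(2) by simp
    show "\<forall>\<phi>\<in>?Z. (\<forall>w\<in>U. \<phi> w \<le> 0) \<longrightarrow> \<phi> = (\<lambda>_. 0)"
      by (intro ballI impI insert.prems(3)[rule_format]) auto
  qed
  show ?case
  proof (cases "?Z = E")
    case True
    have "\<phi> u = 0" if "\<phi> \<in> E" for \<phi>
    proof -
      have "\<phi> \<in> ?Z" using that by (simp only: True)
      then show ?thesis by simp
    qed
    then have "?P = {}" by fastforce
    then have "euler (positive_sets E (insert u U)) = euler (positive_sets E U)"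
      unfolding step \<open>?P = {}\<close> by (simp add: euler_no_points)
    then show ?thesis using Z True by simp
  next
    case False
    then obtain \<chi> where \<chi>: "\<chi> \<in> E" "\<chi> u \<noteq> 0" by auto
    obtain \<xi> where \<xi>: "\<xi> \<in> E" "\<xi> u * \<chi> u < 0"
      using open_convex_zero_sign[OF insert.prems(1,2) _ \<chi>] by auto
    obtain \<psi> \<zeta> where signs: "\<psi> \<in> E" "\<psi> u > 0" "\<zeta> \<in> E" "\<zeta> u < 0"
    proof (cases "\<chi> u > 0")
      case True
      then show ?thesis using that[OF \<chi>(1) _ \<xi>(1)] \<xi>(2) by (simp add: mult_less_0_iff)
    next
      case False
      then show ?thesis using that[OF \<xi>(1) _ \<chi>(1)] \<xi>(2) \<chi>(2) by (simp add: mult_less_0_iff)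
    qed
    have "euler (positive_sets ?N U) = 0"
      using insert.hyps(1) secs(2)
    proof (rule euler_covered)
      show "?N \<noteq> {}" using signs by auto
      show "\<forall>\<phi>\<in>?N. \<exists>w\<in>U. \<phi> w > 0"
      proof (rule ballI, rule ccontr)
        fix \<phi> assume "\<phi> \<in> ?N" "\<not> (\<exists>w\<in>U. \<phi> w > 0)"
        then have "\<phi> \<in> E" "\<phi> u < 0" "\<forall>w\<in>insert u U. \<phi> w \<le> 0" by (auto simp: not_less)
        then show False using insert.prems(3) by fastforce
      qed
    qed
    then show ?thesis
      unfolding step euler_hyperplane_split[OF insert.prems(1) insert.hyps(1) signs] using Z by simp
  qed
qed

section \<open>Linear algebra in finitely supported vectors\<close>

text \<open>
  Vectors over \<open>\<bbbk>\<close> are functions on \<open>nat\<close>, as in the definition of \<open>kdim\<close>, and the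
  finite-dimensional spaces \<open>\<bbbk>\<^sup>B\<close> are subspaces of one ambient space of infinite dimension. The
  facts of linear algebra below are therefore relative to subspaces of some \<open>\<bbbk>\<^sup>B\<close> with \<open>B\<close> finite.
\<close>

definition vecs :: "nat set \<Rightarrow> (nat \<Rightarrow> 'k::field) set" where
  "vecs B = {v. \<forall>j. j \<notin> B \<longrightarrow> v j = 0}"

interpretation fv: vector_space "\<lambda>(a::'k::field) v (j::nat). a * v j"
  by unfold_locales (auto simp: algebra_simps)

interpretation fvp: vector_space_pair "\<lambda>(a::'k::field) v (j::nat). a * v j" "\<lambda>(a::'k::field) v (j::nat). a * v j"
  by unfold_locales

definition linear_map :: "((nat \<Rightarrow> 'k::field) \<Rightarrow> (nat \<Rightarrow> 'k)) \<Rightarrow> bool" where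
  "linear_map f \<longleftrightarrow> Vector_Spaces.linear (\<lambda>a v j. a * v j) (\<lambda>a v j. a * v j) f"

lemma linear_mapI:
  assumes "\<And>x y. f (x + y) = f x + f y" "\<And>c x. f (\<lambda>j. c * x j) = (\<lambda>j. c * f x j)"
  shows "linear_map f"
  unfolding linear_map_def Vector_Spaces.linear_iff using assms fv.vector_space_axioms by blast

lemma unit_vector_independent: "\<not> fv.dependent ((\<lambda>b j. (if j = b then 1 else 0 :: 'k::field)) ` B)"
proof -
  define e where "e = (\<lambda>(b::nat) j. (if j = b then 1 else 0 :: 'k))"
  have inj: "inj_on e X" for X by (auto simp: inj_on_def e_def fun_eq_iff)
  show ?thesis unfolding fv.independent_explicit_finite_subsets e_def[symmetric]
  proof (intro allI impI ballI)
    fix S c v assume S: "S \<subseteq> e ` B" "finite S" and z: "(\<Sum>v\<in>S. (\<lambda>j. c v * v j)) = 0" and v: "v \<in> S"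
    obtain X where X: "S = e ` X" "finite X" using S by (meson finite_subset_image)
    then obtain b where b: "b \<in> X" "v = e b" using v by auto
    have "(\<Sum>v\<in>S. (\<lambda>j. c v * v j)) b = (\<Sum>x\<in>X. c (e x) * e x b)"
      unfolding X(1) sum.reindex[OF inj] by (induction X rule: infinite_finite_induct) auto
    also have "\<dots> = (\<Sum>x\<in>X. if x = b then c (e x) else 0)" by (rule sum.cong) (auto simp: e_def)
    also have "\<dots> = c v" using b X(2) by simp
    finally show "c v = 0" using z by simp
  qed
qed

lemma sum_fun_apply: "(\<Sum>x\<in>X. f x) j = (\<Sum>x\<in>X. f x j)"
  for f :: "'a \<Rightarrow> 'b \<Rightarrow> 'c::comm_monoid_add"
  by (induction X rule: infinite_finite_induct) auto

lemma vecs_subset_span: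
  assumes "finite B"
  shows "vecs B \<subseteq> fv.span ((\<lambda>b j. (if j = b then 1 else 0 :: 'k::field)) ` B)"
proof
  fix v :: "nat \<Rightarrow> 'k" assume v: "v \<in> vecs B"
  have "v = (\<Sum>b\<in>B. (\<lambda>j. v b * (if j = b then 1 else 0)))"
  proof
    fix j show "v j = (\<Sum>b\<in>B. (\<lambda>j. v b * (if j = b then 1 else 0))) j"
      unfolding sum_fun_apply using v assms by (simp add: vecs_def if_distrib cong: if_cong)
  qed
  also have "\<dots> \<in> fv.span ((\<lambda>b j. (if j = b then 1 else 0)) ` B)"
    by (intro fv.span_sum fv.span_scale fv.span_base) auto
  finally show "v \<in> fv.span ((\<lambda>b j. (if j = b then 1 else 0)) ` B)" .
qed

lemma subspace_vecs: "fv.subspace (vecs B)"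
  by (auto simp: fv.subspace_def vecs_def)

lemma kdim_vecs: "finite B \<Longrightarrow> kdim (vecs B :: (nat \<Rightarrow> 'k::field) set) = card B"
proof (rule fv.dim_unique[OF _ vecs_subset_span unit_vector_independent])
  show "(\<lambda>b j. if j = b then 1 else 0 :: 'k) ` B \<subseteq> vecs B" by (auto simp: vecs_def)
  show "card ((\<lambda>b j. if j = b then 1 else 0 :: 'k) ` B) = card B"
    by (intro card_image) (auto simp: inj_on_def fun_eq_iff)
qed

lemma finite_independent_vecs:
  assumes "finite B" "S \<subseteq> vecs B" "\<not> fv.dependent S"
  shows "finite S"
  using fv.independent_span_bound[OF finite_imageI[OF assms(1)] assms(3)]
    vecs_subset_span[OF assms(1)] assms(2) by blast

lemma rank_nullity:
  assumes f: "linear_map f" and V: "fv.subspace V" "V \<subseteq> vecs B" "finite B"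
  shows "kdim V = kdim {v\<in>V. f v = 0} + kdim (f ` V)"
proof -
  have lf: "Vector_Spaces.linear (\<lambda>a v j. a * v j) (\<lambda>a v j. a * v j) f"
    using f unfolding linear_map_def .
  let ?N = "{v\<in>V. f v = 0}"
  obtain C where C: "C \<subseteq> ?N" "\<not> fv.dependent C" "?N \<subseteq> fv.span C" "card C = kdim ?N"
    using fv.basis_exists by blast
  obtain D where D: "C \<subseteq> D" "D \<subseteq> V" "\<not> fv.dependent D" "V \<subseteq> fv.span D"
    using fv.maximal_independent_subset_extend[of C V] C by blast
  have fin: "finite D" using finite_independent_vecs[OF V(3) _ D(3)] D(2) V(2) by blast
  have spanD: "fv.span D = V" using D V(1) by (simp add: fv.span_minimal subset_antisym)
  have inj: "inj_on f (fv.span (D - C))"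
    unfolding fvp.linear_inj_on_iff_eq_0[OF lf fv.subspace_span]
  proof (intro ballI impI)
    fix x assume x: "x \<in> fv.span (D - C)" "f x = 0"
    have "x \<in> V" using x fv.span_mono[of "D - C" D] spanD by blast
    then have "x \<in> fv.span C" using x C(3) by blast
    \<comment> \<open>\<open>x\<close> lies in the spans of two disjoint parts of the basis \<open>D\<close>\<close>
    then have "fv.representation D x = fv.representation C x"
      using D fv.representation_extend[OF D(3)] by (metis)
    moreover have "fv.representation D x = fv.representation (D - C) x"
      using fv.representation_extend[OF D(3) x(1)] by auto
    ultimately have "fv.representation D x b = 0" for b
      using fv.representation_ne_zero[of C x b] fv.representation_ne_zero[of "D - C" x b] by auto
    then show "x = 0"
      using fv.sum_nonzero_representation_eq[OF D(3), of x] \<open>x \<in> V\<close> D(4) by auto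
  qed
  have indep: "\<not> fv.dependent (f ` (D - C))"
    using fvp.linear_independent_injective_image[OF lf, of "D - C"] inj
      fv.independent_mono[OF D(3)] by blast
  have span: "f ` V \<subseteq> fv.span (f ` (D - C))"
  proof -
    have "f ` V = fv.span (f ` D)" using fvp.linear_span_image[OF lf, of D] spanD by simp
    moreover have "f ` D \<subseteq> fv.span (f ` (D - C))"
    proof
      fix y assume "y \<in> f ` D"
      then obtain x where x: "x \<in> D" "y = f x" by blast
      show "y \<in> fv.span (f ` (D - C))"
      proof (cases "x \<in> C")
        case True
        then have "y = 0" using C(1) x(2) by blast
        then show ?thesis by (simp only: fv.span_zero)
      next
        case False
        then show ?thesis using x by (intro fv.span_base) blast
      qed
    qed
    ultimately show ?thesis using fv.span_minimal[OF _ fv.subspace_span] by simp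
  qed
  have "kdim (f ` V) = card (f ` (D - C))"
    by (rule fv.dim_unique[OF _ span indep refl]) (use D(2) in blast)
  also have "\<dots> = card (D - C)"
    by (rule card_image[OF inj_on_subset[OF inj fv.span_superset]])
  also have "\<dots> = card D - card C" using D(1) fin by (simp add: card_Diff_subset finite_subset)
  finally show ?thesis
    using fv.basis_card_eq_dim[OF D(2,4,3)] C(4) card_mono[OF fin D(1)] by simp
qed

lemma subspace_eq_of_dim_le:
  assumes "fv.subspace V" "V \<subseteq> W" "W \<subseteq> vecs B" "finite B" "kdim W \<le> kdim V"
  shows "V = W"
proof -
  obtain C where C: "C \<subseteq> V" "\<not> fv.dependent C" "V \<subseteq> fv.span C" "card C = kdim V"
    using fv.basis_exists by blast
  obtain D where D: "C \<subseteq> D" "D \<subseteq> W" "\<not> fv.dependent D" "W \<subseteq> fv.span D"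
    using fv.maximal_independent_subset_extend[of C W] C assms(2) by blast
  have fin: "finite D" using finite_independent_vecs[OF assms(4) _ D(3)] D(2) assms(3) by blast
  have "card D \<le> card C" using fv.basis_card_eq_dim[OF D(2,4,3)] C(4) assms(5) by simp
  then have "C = D" using D(1) fin by (simp add: card_subset_eq card_mono order_antisym)
  then have "W \<subseteq> fv.span C" using D(4) by simp
  also have "\<dots> \<subseteq> V" using C(1) assms(1) by (rule fv.span_minimal)
  finally show ?thesis using assms(2) by blast
qed

section \<open>Complexes of vector spaces\<close>

definition mat_on :: "nat set \<Rightarrow> nat set \<Rightarrow> (nat \<Rightarrow> nat \<Rightarrow> 'k::field) \<Rightarrow> (nat \<Rightarrow> 'k) \<Rightarrow> (nat \<Rightarrow> 'k)" where
  "mat_on R C a v = (\<lambda>r. if r \<in> R then (\<Sum>c\<in>C. a r c * v c) else 0)"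

type_synonym 'k matrices = "nat \<Rightarrow> nat \<Rightarrow> nat \<Rightarrow> 'k"

text \<open>
  A based complex consists of finite sets \<open>B i\<close> of basis vectors in degree \<open>i\<close> and of one family of
  matrices \<open>a i\<close>, where the differential from degree \<open>i + 1\<close> to degree \<open>i\<close> is the block of \<open>a i\<close> with
  rows in \<open>B i\<close> and columns in \<open>B (i + 1)\<close>. Keeping the matrices and varying \<open>B\<close> gives
  subcomplexes and quotient complexes without change of notation.
\<close>

definition dif :: "'k::field matrices \<Rightarrow> (nat \<Rightarrow> nat set) \<Rightarrow> nat \<Rightarrow> (nat \<Rightarrow> 'k) \<Rightarrow> (nat \<Rightarrow> 'k)" where
  "dif a B i = mat_on (B i) (B (Suc i)) (a i)"

definition kcycles :: "'k::field matrices \<Rightarrow> (nat \<Rightarrow> nat set) \<Rightarrow> nat \<Rightarrow> (nat \<Rightarrow> 'k) set" where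
  "kcycles a B i = {v \<in> vecs (B i). \<forall>i'. i = Suc i' \<longrightarrow> dif a B i' v = (\<lambda>_. 0)}"

definition exact_at :: "'k::field matrices \<Rightarrow> (nat \<Rightarrow> nat set) \<Rightarrow> nat \<Rightarrow> bool" where
  "exact_at a B i \<longleftrightarrow> kcycles a B i = dif a B i ` vecs (B (Suc i))"

definition is_complex :: "'k::field matrices \<Rightarrow> (nat \<Rightarrow> nat set) \<Rightarrow> bool" where
  "is_complex a B \<longleftrightarrow> (\<forall>i. finite (B i)) \<and>
     (\<forall>i. \<forall>v\<in>vecs (B (Suc (Suc i))). dif a B i (dif a B (Suc i) v) = (\<lambda>_. 0))"

text \<open>
  The vanishing of the entries from \<open>B'\<close> to \<open>B''\<close> says that \<open>B'\<close> spans a subcomplex; then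
  \<open>B''\<close> is a basis of the quotient, and \<open>0 \<rightarrow> B' \<rightarrow> B \<rightarrow> B'' \<rightarrow> 0\<close> is a short exact
  sequence of complexes.
\<close>

definition splits :: "'k::field matrices \<Rightarrow> (nat \<Rightarrow> nat set) \<Rightarrow> (nat \<Rightarrow> nat set) \<Rightarrow> (nat \<Rightarrow> nat set) \<Rightarrow> bool" where
  "splits a B B' B'' \<longleftrightarrow> (\<forall>i. B i = B' i \<union> B'' i \<and> B' i \<inter> B'' i = {}) \<and>
     (\<forall>i. \<forall>c\<in>B' (Suc i). \<forall>r\<in>B'' i. a i r c = 0)"

definition restrict :: "nat set \<Rightarrow> (nat \<Rightarrow> 'k::field) \<Rightarrow> (nat \<Rightarrow> 'k)" where
  "restrict S v = (\<lambda>j. if j \<in> S then v j else 0)"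

lemma linear_mat_on: "linear_map (mat_on R C a)"
  by (rule linear_mapI)
    (auto simp: mat_on_def fun_eq_iff algebra_simps sum.distrib sum_distrib_left)

lemma linear_restrict: "linear_map (restrict S)"
  by (rule linear_mapI) (auto simp: restrict_def fun_eq_iff)

lemma linear_dif: "linear_map (dif a B i)"
  unfolding dif_def by (rule linear_mat_on)

lemma linear_map_diff: "linear_map f \<Longrightarrow> f (x - y) = f x - f y"
  unfolding linear_map_def by (rule fvp.linear_diff)

lemma dif_in_vecs: "dif a B i v \<in> vecs (B i)"
  by (simp add: dif_def mat_on_def vecs_def)

lemma restrict_in_vecs: "restrict S v \<in> vecs S"
  by (simp add: restrict_def vecs_def)

lemma subspace_kcycles: "fv.subspace (kcycles a B i)"
proof -
  have lin: "dif a B i' (x + y) = dif a B i' x + dif a B i' y"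
    "dif a B i' (\<lambda>j. c * x j) = (\<lambda>j. c * dif a B i' x j)" "dif a B i' 0 = 0" for i' x y c
    using linear_dif[of a B i'] fvp.linear_add fvp.linear_scale fvp.linear_0
    unfolding linear_map_def by blast+
  show ?thesis
    using subspace_vecs[of "B i"]
    unfolding fv.subspace_def kcycles_def zero_fun_def[symmetric] by (auto simp: lin)
qed

context
  fixes a :: "'k::field matrices" and B B' B''
  assumes split: "splits a B B' B''" and cx: "is_complex a B"
begin

lemma splits_finite: "finite (B i)" "finite (B' i)" "finite (B'' i)"
proof -
  have *: "finite (B i)" "B i = B' i \<union> B'' i" using split cx by (auto simp: splits_def is_complex_def)
  then show "finite (B i)" "finite (B' i)" "finite (B'' i)" by auto
qed

lemma vecs_sub: "v \<in> vecs (B' i) \<Longrightarrow> v \<in> vecs (B i)" "v \<in> vecs (B'' i) \<Longrightarrow> v \<in> vecs (B i)"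
  using split by (auto simp: splits_def vecs_def)

lemma dif_sub:
  assumes "v \<in> vecs (B' (Suc i))"
  shows "dif a B i v = dif a B' i v"
proof
  fix r
  have B: "B j = B' j \<union> B'' j" "B' j \<inter> B'' j = {}" for j using split by (auto simp: splits_def)
  have "(\<Sum>c\<in>B (Suc i). a i r c * v c) = (\<Sum>c\<in>B' (Suc i). a i r c * v c)"
    using splits_finite[of "Suc i"] assms B[of "Suc i"]
    by (intro sum.mono_neutral_right) (auto simp: vecs_def)
  moreover have "(\<Sum>c\<in>B' (Suc i). a i r c * v c) = 0" if "r \<in> B'' i"
    using split that by (intro sum.neutral) (auto simp: splits_def)
  ultimately show "dif a B i v r = dif a B' i v r"
    unfolding dif_def mat_on_def using B[of i] by auto
qed

lemma dif_quotient:
  "dif a B'' i (restrict (B'' (Suc i)) v) = restrict (B'' i) (dif a B i v)"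
proof
  fix r
  have B: "B j = B' j \<union> B'' j" "B' j \<inter> B'' j = {}" for j using split by (auto simp: splits_def)
  have "(\<Sum>c\<in>B (Suc i). a i r c * v c) =
      (\<Sum>c\<in>B'' (Suc i). a i r c * restrict (B'' (Suc i)) v c)" if "r \<in> B'' i"
    using splits_finite[of "Suc i"] B[of "Suc i"] split that
    by (intro sum.mono_neutral_cong_right) (auto simp: restrict_def splits_def)
  then show "dif a B'' i (restrict (B'' (Suc i)) v) r = restrict (B'' i) (dif a B i v) r"
    unfolding dif_def mat_on_def restrict_def using B[of i] by auto
qed

lemma restrict_eq_0: "v \<in> vecs (B i) \<Longrightarrow> restrict (B'' i) v = (\<lambda>_. 0) \<longleftrightarrow> v \<in> vecs (B' i)"
proof -
  have "B i = B' i \<union> B'' i" "B' i \<inter> B'' i = {}" using split by (auto simp: splits_def)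
  moreover assume "v \<in> vecs (B i)"
  ultimately show ?thesis by (auto simp: restrict_def vecs_def fun_eq_iff)
qed

lemma restrict_id: "v \<in> vecs (B'' i) \<Longrightarrow> restrict (B'' i) v = v"
  by (auto simp: restrict_def vecs_def fun_eq_iff)

lemma is_complex_quotient: "is_complex a B''"
  unfolding is_complex_def
proof (intro conjI allI ballI)
  fix i and v :: "nat \<Rightarrow> 'k" assume v: "v \<in> vecs (B'' (Suc (Suc i)))"
  have "dif a B'' i (dif a B'' (Suc i) v) = restrict (B'' i) (dif a B i (dif a B (Suc i) v))"
    using dif_quotient[of "Suc i" v] dif_quotient[of i] restrict_id[OF v] by simp
  then show "dif a B'' i (dif a B'' (Suc i) v) = (\<lambda>_. 0)"
    using cx vecs_sub(2)[OF v] by (auto simp: is_complex_def restrict_def fun_eq_iff)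
qed (rule splits_finite)

text \<open>
  A cycle of the quotient becomes a cycle of \<open>B\<close> after a correction in \<open>B'\<close>: its boundary in \<open>B\<close> is a
  cycle of \<open>B'\<close>, hence the boundary of the correction. Only those cycles of \<open>B'\<close> have to be boundaries
  in \<open>B'\<close> that are boundaries in \<open>B\<close>; that is, the map on homology induced by the inclusion has to be
  injective in the degree below.
\<close>

lemma lift_cycle:
  assumes v: "v \<in> kcycles a B'' i" and ex: "\<And>i'. i = Suc i' \<Longrightarrow>
      \<forall>x\<in>kcycles a B' i'. x \<in> dif a B i' ` vecs (B (Suc i')) \<longrightarrow> x \<in> dif a B' i' ` vecs (B' (Suc i'))"
  shows "\<exists>w\<in>vecs (B' i). v - w \<in> kcycles a B i"
proof (cases i)
  case 0
  have "(\<lambda>_. 0) \<in> vecs (B' i)" by (simp add: vecs_def)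
  moreover have "v - (\<lambda>_. 0) \<in> kcycles a B i"
    using v vecs_sub(2) 0 by (auto simp: kcycles_def vecs_def)
  ultimately show ?thesis by blast
next
  case (Suc n)
  have v'': "v \<in> vecs (B'' (Suc n))" using v Suc by (simp add: kcycles_def)
  let ?x = "dif a B n v"
  have "restrict (B'' n) ?x = (\<lambda>_. 0)"
    using dif_quotient[of n v] restrict_id[OF v''] v Suc by (simp add: kcycles_def)
  then have x: "?x \<in> vecs (B' n)" using restrict_eq_0[of ?x n] dif_in_vecs[of a B n v] by blast
  have "dif a B' n' ?x = (\<lambda>_. 0)" if "n = Suc n'" for n'
    using dif_sub[of ?x n'] x that cx vecs_sub(2)[OF v''] by (simp add: is_complex_def)
  then have "?x \<in> kcycles a B' n" using x by (simp add: kcycles_def)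
  then obtain w where w: "w \<in> vecs (B' (Suc n))" "?x = dif a B' n w"
    using ex[OF Suc] vecs_sub(2)[OF v''] by blast
  have "dif a B n (v - w) = (\<lambda>_. 0)"
    using w dif_sub[OF w(1)] by (simp add: linear_map_diff[OF linear_dif] fun_eq_iff)
  moreover have "v - w \<in> vecs (B (Suc n))"
    using vecs_sub(2)[OF v''] vecs_sub(1)[OF w(1)] by (simp add: vecs_def)
  ultimately show ?thesis using w(1) Suc by (auto simp: kcycles_def)
qed

lemma boundary_is_cycle: "is_complex a A \<Longrightarrow> u \<in> vecs (A (Suc i)) \<Longrightarrow> dif a A i u \<in> kcycles a A i"
  using dif_in_vecs by (auto simp: kcycles_def is_complex_def)

text \<open>
  This is the part \<open>H\<^sub>i(B) \<rightarrow> H\<^sub>i(B'') \<rightarrow> H\<^bsub>i-1\<^esub>(B') \<rightarrow> H\<^bsub>i-1\<^esub>(B)\<close> of the long exact sequence.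
\<close>

lemma exact_quotient_if_injective:
  assumes ex: "exact_at a B i" and ex': "\<And>i'. i = Suc i' \<Longrightarrow>
      \<forall>x\<in>kcycles a B' i'. x \<in> dif a B i' ` vecs (B (Suc i')) \<longrightarrow> x \<in> dif a B' i' ` vecs (B' (Suc i'))"
  shows "exact_at a B'' i"
  unfolding exact_at_def
proof (intro equalityI subsetI)
  fix v assume v: "v \<in> kcycles a B'' i"
  obtain w where w: "w \<in> vecs (B' i)" "v - w \<in> kcycles a B i"
    using lift_cycle[OF v ex'] by blast
  then obtain u where u: "u \<in> vecs (B (Suc i))" "v - w = dif a B i u"
    using ex unfolding exact_at_def by blast
  have v'': "v \<in> vecs (B'' i)" using v by (simp add: kcycles_def)
  have "restrict (B'' i) (v - w) = v"
    using linear_map_diff[OF linear_restrict, of "B'' i" v w] restrict_id[OF v'']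
      restrict_eq_0[OF vecs_sub(1)[OF w(1)]] w(1) by (simp add: fun_eq_iff)
  then have "v = dif a B'' i (restrict (B'' (Suc i)) u)"
    using dif_quotient[of i u] u(2) by simp
  then show "v \<in> dif a B'' i ` vecs (B'' (Suc i))" using restrict_in_vecs by blast
next
  fix v assume "v \<in> dif a B'' i ` vecs (B'' (Suc i))"
  then show "v \<in> kcycles a B'' i" using boundary_is_cycle[OF is_complex_quotient] by blast
qed

lemma exact_quotient:
  assumes "exact_at a B i" "\<And>i'. i = Suc i' \<Longrightarrow> exact_at a B' i'"
  shows "exact_at a B'' i"
  using assms(2) by (intro exact_quotient_if_injective[OF assms(1)]) (auto simp: exact_at_def)

text \<open>
  Cycles of the quotient lift when \<open>B'\<close> is exact one degree below, so restriction to \<open>B''\<close> is then a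
  surjection of spaces of cycles, with kernel the cycles of \<open>B'\<close>.
\<close>

lemma cycles_dim_split:
  assumes ex: "\<And>i'. i = Suc i' \<Longrightarrow> exact_at a B' i'"
  shows "kdim (kcycles a B i) = kdim (kcycles a B' i) + kdim (kcycles a B'' i)"
proof -
  have kc: "kcycles a B i \<subseteq> vecs (B i)" by (auto simp: kcycles_def)
  have ker: "{v \<in> kcycles a B i. restrict (B'' i) v = 0} = kcycles a B' i"
  proof (intro equalityI subsetI)
    fix v assume v: "v \<in> {v \<in> kcycles a B i. restrict (B'' i) v = 0}"
    then have "v \<in> vecs (B' i)" using restrict_eq_0[of v i] kc by (auto simp: zero_fun_def)
    then show "v \<in> kcycles a B' i" using v dif_sub by (auto simp: kcycles_def)
  next
    fix v assume v: "v \<in> kcycles a B' i"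
    then have v': "v \<in> vecs (B' i)" by (simp add: kcycles_def)
    then have "restrict (B'' i) v = 0"
      using restrict_eq_0[OF vecs_sub(1)[OF v']] by (simp add: zero_fun_def)
    then show "v \<in> {v \<in> kcycles a B i. restrict (B'' i) v = 0}"
      using v vecs_sub(1)[OF v'] dif_sub by (auto simp: kcycles_def)
  qed
  have im: "restrict (B'' i) ` kcycles a B i = kcycles a B'' i"
  proof (intro equalityI subsetI)
    fix v assume v: "v \<in> kcycles a B'' i"
    obtain w where w: "w \<in> vecs (B' i)" "v - w \<in> kcycles a B i"
      using lift_cycle[OF v] ex unfolding exact_at_def by blast
    have "restrict (B'' i) (v - w) = v"
      using linear_map_diff[OF linear_restrict, of "B'' i" v w] restrict_id[of v i] v
        restrict_eq_0[OF vecs_sub(1)[OF w(1)]] w(1) by (simp add: kcycles_def fun_eq_iff)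
    then show "v \<in> restrict (B'' i) ` kcycles a B i" using w(2) by (metis imageI)
  next
    fix v assume "v \<in> restrict (B'' i) ` kcycles a B i"
    then obtain w where w: "w \<in> kcycles a B i" "v = restrict (B'' i) w" by blast
    have "dif a B'' i' v = (\<lambda>_. 0)" if "i = Suc i'" for i'
      using w that dif_quotient[of i' w] by (auto simp: kcycles_def restrict_def)
    then show "v \<in> kcycles a B'' i" using w(2) restrict_in_vecs by (auto simp: kcycles_def)
  qed
  show ?thesis
    using rank_nullity[OF linear_restrict subspace_kcycles kc splits_finite(1), of "B'' i"]
    unfolding ker im .
qed

end

text \<open>
  When the complex is exact in degree \<open>n\<close>, its cycles there are the boundaries, and this number is the
  alternating sum of the dimensions of the homology in degrees at most \<open>n\<close>. Cutting off at \<open>n\<close> is what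
  makes an Euler characteristic available for a resolution of infinite length.
\<close>

definition truncated_euler :: "'k::field matrices \<Rightarrow> (nat \<Rightarrow> nat set) \<Rightarrow> nat \<Rightarrow> int" where
  "truncated_euler a B n = (\<Sum>i\<le>n. (-1) ^ i * int (card (B i))) - (-1) ^ n * int (kdim (kcycles a B n))"

lemma truncated_euler_split:
  assumes s: "splits a B B' B''" and c: "is_complex a B" and ex: "exact_at a B' n"
  shows "truncated_euler a B (Suc n) = truncated_euler a B' (Suc n) + truncated_euler a B'' (Suc n)"
proof -
  have "card (B i) = card (B' i) + card (B'' i)" for i
    using splits_finite[OF s c, of i] s by (auto simp: splits_def card_Un_disjoint)
  moreover have "kdim (kcycles a B (Suc n)) = kdim (kcycles a B' (Suc n)) + kdim (kcycles a B'' (Suc n))"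
    using ex by (intro cycles_dim_split[OF s c]) auto
  ultimately show ?thesis by (simp add: truncated_euler_def sum.distrib algebra_simps)
qed

lemma card_eq_cycles_plus_rank:
  assumes "finite (B (Suc i))"
  shows "card (B (Suc i)) = kdim (kcycles a B (Suc i)) + kdim (dif a B i ` vecs (B (Suc i)))"
proof -
  have "kcycles a B (Suc i) = {v \<in> vecs (B (Suc i)). dif a B i v = 0}"
    by (auto simp: kcycles_def zero_fun_def)
  then show ?thesis
    using rank_nullity[OF linear_dif subspace_vecs order_refl assms, of a B i] kdim_vecs[OF assms, where 'k='a] by simp
qed

lemma truncated_euler_Suc:
  assumes "is_complex a B" "exact_at a B n"
  shows "truncated_euler a B (Suc n) = truncated_euler a B n"
  using card_eq_cycles_plus_rank[of B n a] assms
  by (simp add: truncated_euler_def exact_at_def is_complex_def algebra_simps)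

lemma truncated_euler_0: "finite (B 0) \<Longrightarrow> truncated_euler a B 0 = 0"
  by (simp add: truncated_euler_def kcycles_def kdim_vecs)

lemma truncated_euler_acyclic:
  assumes "is_complex a B" "\<And>i. exact_at a B i"
  shows "truncated_euler a B n = 0"
  using assms by (induction n) (auto simp: truncated_euler_0 truncated_euler_Suc is_complex_def)

lemma truncated_euler_resolution:
  assumes c: "is_complex a B" and "\<And>i. i > 0 \<Longrightarrow> exact_at a B i" and n: "n > 0"
  shows "truncated_euler a B n = int (card (B 0)) - int (kdim (dif a B 0 ` vecs (B 1)))"
proof -
  have "truncated_euler a B (Suc m) = truncated_euler a B 1" for m
    using assms by (induction m) (auto simp: truncated_euler_Suc)
  then have "truncated_euler a B n = truncated_euler a B 1" using n by (metis Suc_pred)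
  also have "\<dots> = int (card (B 0)) - int (kdim (dif a B 0 ` vecs (B 1)))"
    using card_eq_cycles_plus_rank[of B 0 a] c by (simp add: truncated_euler_def is_complex_def)
  finally show ?thesis .
qed

section \<open>Resolutions with the indeterminates set to one\<close>

text \<open>
  The basis vectors of degree \<open>m\<close> with \<open>m\<close> squarefree, zero on \<open>\<tau>\<close> and one on \<open>T\<close>. For \<open>T = {}\<close>
  these are the degrees dividing the product of the indeterminates outside \<open>\<tau>\<close>, and for
  \<open>\<tau> = {}\<close>, \<open>T = UNIV\<close> the only degree left is the product of all indeterminates.
\<close>

definition block :: "(nat \<Rightarrow> nat) \<Rightarrow> (nat \<Rightarrow> nat \<Rightarrow> ('v \<Rightarrow>\<^sub>0 nat)) \<Rightarrow> 'v set \<Rightarrow> 'v set \<Rightarrow> nat \<Rightarrow> nat set" where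
  "block n g \<tau> T i = {j. j < n i \<and> (\<forall>x. Poly_Mapping.lookup (g i j) x \<le> 1) \<and>
     (\<forall>x\<in>\<tau>. Poly_Mapping.lookup (g i j) x = 0) \<and> (\<forall>x\<in>T. Poly_Mapping.lookup (g i j) x = 1)}"

text \<open>
  Setting all indeterminates to one in a multigraded resolution of a monomial ideal leaves a complex of
  vector spaces with basis vectors of degrees \<open>g i j\<close>, filtered by divisibility of degrees. The part of the
  filtration below a monomial computes the part of the ideal in that degree, which is \<open>\<bbbk>\<close> or \<open>0\<close>. Only the
  squarefree degrees matter here, and \<open>K\<close> consists of the sets \<open>\<tau>\<close> for which the product of the
  indeterminates outside \<open>\<tau>\<close> lies in the ideal.
\<close>

locale filtered_resolution =
  fixes n :: "nat \<Rightarrow> nat" and g :: "nat \<Rightarrow> nat \<Rightarrow> ('v::finite \<Rightarrow>\<^sub>0 nat)"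
    and a :: "'k::field matrices" and e :: "nat \<Rightarrow> 'k" and K :: "'v set set"
  assumes arrow: "\<And>i r c x. r < n i \<Longrightarrow> c < n (Suc i) \<Longrightarrow> a i r c \<noteq> 0 \<Longrightarrow>
      Poly_Mapping.lookup (g i r) x \<le> Poly_Mapping.lookup (g (Suc i) c) x"
    and complex: "\<And>\<tau>. is_complex a (block n g \<tau> {})"
    and exact: "\<And>\<tau> i. i > 0 \<Longrightarrow> exact_at a (block n g \<tau> {}) i"
    and kernel: "\<And>\<tau>. dif a (block n g \<tau> {}) 0 ` vecs (block n g \<tau> {} 1) =
      {v \<in> vecs (block n g \<tau> {} 0). (\<Sum>c<n 0. e c * v c) = 0}"
    and image: "\<And>\<tau>. (\<exists>v\<in>vecs (block n g \<tau> {} 0). (\<Sum>c<n 0. e c * v c) \<noteq> 0) \<longleftrightarrow> \<tau> \<in> K"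
begin

abbreviation Q :: "'v set \<Rightarrow> 'v set \<Rightarrow> nat \<Rightarrow> nat set" where "Q \<equiv> block n g"

text \<open>
  A basis vector has exponent zero or one at \<open>x\<close>, and the differential cannot raise this exponent.
\<close>

lemma splits_block: "splits a (Q \<tau> T) (Q (insert x \<tau>) T) (Q \<tau> (insert x T))"
  unfolding splits_def
proof (intro conjI allI ballI)
  fix i
  show "Q \<tau> T i = Q (insert x \<tau>) T i \<union> Q \<tau> (insert x T) i"
    using le_antisym by (fastforce simp: block_def le_Suc_eq)
  show "Q (insert x \<tau>) T i \<inter> Q \<tau> (insert x T) i = {}" by (auto simp: block_def)
next
  fix i c r assume "c \<in> Q (insert x \<tau>) T (Suc i)" "r \<in> Q \<tau> (insert x T) i"
  then show "a i r c = 0" using arrow[of r i c x] by (auto simp: block_def)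
qed

lemma is_complex_block: "is_complex a (Q \<tau> T)"
  using finite[of T]
proof (induction T arbitrary: \<tau> rule: finite_induct)
  case (insert x T)
  show ?case by (rule is_complex_quotient[OF splits_block insert.IH])
qed (rule complex)

text \<open>
  Each element of \<open>T\<close> is one passage to a quotient, and so shifts homology by at most one degree.
\<close>

lemma exact_block_above: "i > card T \<Longrightarrow> exact_at a (Q \<tau> T) i"
  using finite[of T]
proof (induction T arbitrary: \<tau> i rule: finite_induct)
  case (insert x T)
  then have i: "i > card T" "\<And>i'. i = Suc i' \<Longrightarrow> i' > card T" by auto
  show ?case
    by (rule exact_quotient[OF splits_block is_complex_block]) (use i insert.IH in auto)
qed (use exact in simp)

lemma scalar_scale: "(\<Sum>c<n 0. e c * (s * v c)) = s * (\<Sum>c<n 0. e c * v c)"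
  by (simp add: sum_distrib_left algebra_simps)

lemma scalar_linear: "linear_map (\<lambda>v j. if j = (0::nat) then (\<Sum>c<n 0. e c * v c) else 0)"
  by (rule linear_mapI) (auto simp: fun_eq_iff algebra_simps sum.distrib sum_distrib_left)

lemma truncated_euler_block_base:
  assumes "m > 0"
  shows "truncated_euler a (Q \<tau> {}) m = (if \<tau> \<in> K then 1 else 0)"
proof -
  let ?B = "Q \<tau> {}" and ?f = "\<lambda>v j. if j = (0::nat) then (\<Sum>c<n 0. e c * v c) else 0"
  have fin: "finite (?B 0)" using complex by (simp add: is_complex_def)
  have ker: "{v \<in> vecs (?B 0). ?f v = 0} = dif a ?B 0 ` vecs (?B 1)"
    unfolding kernel by (auto simp: fun_eq_iff)
  have "kdim (?f ` vecs (?B 0)) = (if \<tau> \<in> K then 1 else 0)"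
  proof (cases "\<tau> \<in> K")
    case True
    then obtain v where v: "v \<in> vecs (?B 0)" "(\<Sum>c<n 0. e c * v c) \<noteq> 0" using image by blast
    have "?f ` vecs (?B 0) = vecs {0}"
    proof (intro equalityI subsetI)
      fix w :: "nat \<Rightarrow> 'k" assume w: "w \<in> vecs {0}"
      let ?s = "w 0 / (\<Sum>c<n 0. e c * v c)"
      have "(\<Sum>c<n 0. e c * (?s * v c)) = ?s * (\<Sum>c<n 0. e c * v c)" by (rule scalar_scale)
      also have "\<dots> = w 0" using v(2) by simp
      finally have "w = ?f (\<lambda>j. ?s * v j)" using w by (simp add: vecs_def fun_eq_iff)
      moreover have "(\<lambda>j. ?s * v j) \<in> vecs (?B 0)" using v(1) by (simp add: vecs_def)
      ultimately show "w \<in> ?f ` vecs (?B 0)" by (rule image_eqI)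
    qed (auto simp: vecs_def)
    then show ?thesis using True kdim_vecs[of "{0}"] by simp
  next
    case False
    then have "\<forall>v\<in>vecs (?B 0). ?f v = (\<lambda>_. 0)" using image[of \<tau>] by (auto simp: fun_eq_iff)
    moreover have "(\<lambda>_. 0) \<in> vecs (?B 0)" by (simp add: vecs_def)
    ultimately have "?f ` vecs (?B 0) = {\<lambda>_. 0}" by (auto simp: image_def intro!: bexI[of _ "\<lambda>_. 0"])
    also have "\<dots> = vecs {}" by (auto simp: vecs_def)
    finally show ?thesis using False kdim_vecs[of "{}", where 'k='k] by simp
  qed
  moreover have "card (?B 0) = kdim (dif a ?B 0 ` vecs (?B 1)) + kdim (?f ` vecs (?B 0))"
    using rank_nullity[OF scalar_linear subspace_vecs order_refl fin]
    unfolding ker kdim_vecs[OF fin] .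
  moreover have "truncated_euler a ?B m = int (card (?B 0)) - int (kdim (dif a ?B 0 ` vecs (?B 1)))"
    by (rule truncated_euler_resolution[OF complex exact assms])
  ultimately have "truncated_euler a ?B m = int (if \<tau> \<in> K then 1 else 0)" by linarith
  then show ?thesis by simp
qed

lemma sum_Pow_insert:
  fixes h :: "'v set \<Rightarrow> int"
  assumes "finite T" "x \<notin> T"
  shows "(\<Sum>\<tau>\<in>Pow (insert x T). h \<tau>) = (\<Sum>\<tau>\<in>Pow T. h \<tau>) + (\<Sum>\<tau>\<in>Pow T. h (insert x \<tau>))"
proof -
  have "inj_on (insert x) (Pow T)" using assms(2) by (auto simp: inj_on_def insert_ident subset_iff)
  moreover have "Pow T \<inter> insert x ` Pow T = {}" using assms(2) by auto
  ultimately show ?thesis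
    using assms(1) by (simp add: Pow_insert sum.union_disjoint sum.reindex)
qed

text \<open>
  By additivity this is inclusion and exclusion over the exponents in \<open>T\<close>. The bound on \<open>m\<close> ensures that
  every subcomplex used is exact where it is cut off.
\<close>

lemma truncated_euler_block:
  "m > card T \<Longrightarrow> truncated_euler a (Q \<tau> T) m = (\<Sum>\<tau>'\<in>Pow T. (-1) ^ card \<tau>' * (if \<tau> \<union> \<tau>' \<in> K then 1 else 0))"
  using finite[of T]
proof (induction T arbitrary: \<tau> m rule: finite_induct)
  case empty
  then show ?case using truncated_euler_block_base by simp
next
  case (insert x T)
  then obtain l where l: "m = Suc l" "l > card T" by (cases m) auto
  have "truncated_euler a (Q \<tau> T) m = truncated_euler a (Q (insert x \<tau>) T) m + truncated_euler a (Q \<tau> (insert x T)) m"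
    unfolding l(1) by (rule truncated_euler_split[OF splits_block is_complex_block exact_block_above[OF l(2)]])
  then have "truncated_euler a (Q \<tau> (insert x T)) m = truncated_euler a (Q \<tau> T) m - truncated_euler a (Q (insert x \<tau>) T) m" by simp
  also have "\<dots> = (\<Sum>\<tau>'\<in>Pow T. (-1) ^ card \<tau>' * (if \<tau> \<union> \<tau>' \<in> K then 1 else 0)) -
      (\<Sum>\<tau>'\<in>Pow T. (-1) ^ card \<tau>' * (if insert x \<tau> \<union> \<tau>' \<in> K then 1 else 0))"
    using insert.IH[of m] l by simp
  also have "\<dots> = (\<Sum>\<tau>'\<in>Pow (insert x T). (-1) ^ card \<tau>' * (if \<tau> \<union> \<tau>' \<in> K then 1 else 0))"
  proof -
    have "card (insert x \<tau>') = Suc (card \<tau>')" if "\<tau>' \<in> Pow T" for \<tau>'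
      using that insert.hyps by (subst card_insert_disjoint) (auto intro: finite_subset)
    then have "(\<Sum>\<tau>'\<in>Pow T. (-1) ^ card (insert x \<tau>') * (if \<tau> \<union> insert x \<tau>' \<in> K then 1 else 0)) =
        - (\<Sum>\<tau>'\<in>Pow T. (-1 :: int) ^ card \<tau>' * (if insert x \<tau> \<union> \<tau>' \<in> K then 1 else 0))"
      unfolding sum_negf[symmetric] by (intro sum.cong refl) simp
    then show ?thesis
      unfolding sum_Pow_insert[OF insert.hyps] by linarith
  qed
  finally show ?case .
qed

theorem euler_eq_0_if_exact:
  assumes "\<And>i. exact_at a (Q {} UNIV) i"
  shows "euler K = 0"
proof -
  have "0 = truncated_euler a (Q {} UNIV) (Suc (card (UNIV :: 'v set)))"
    using truncated_euler_acyclic[OF is_complex_block assms] by simp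
  also have "\<dots> = (\<Sum>\<tau>\<in>UNIV. (-1) ^ card \<tau> * (if \<tau> \<in> K then 1 else 0))"
    by (subst truncated_euler_block) auto
  also have "\<dots> = euler K"
    unfolding euler_def by (intro sum.mono_neutral_cong_right) auto
  finally show ?thesis by simp
qed

text \<open>
  If \<open>K\<close> is a cone with apex \<open>x\<close>, then \<open>\<tau>\<close> and \<open>insert x \<tau>\<close> are both in \<open>K\<close> or both not in
  \<open>K\<close>. So the inclusion of the part with exponent zero at \<open>x\<close> is an isomorphism on homology, and its
  quotient is exact.
\<close>

lemma exact_block_cone_point:
  assumes cone: "\<And>\<tau>. \<tau> \<in> K \<Longrightarrow> insert x \<tau> \<in> K"
  shows "exact_at a (Q \<tau> {x}) i"
proof (cases i)
  case 0
  note sp = splits_block[of \<tau> "{}" x] and cx = complex[of \<tau>]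
  show ?thesis unfolding exact_at_def 0
  proof (intro equalityI subsetI)
    fix v assume "v \<in> kcycles a (Q \<tau> {x}) 0"
    then have v'': "v \<in> vecs (Q \<tau> {x} 0)" by (simp add: kcycles_def)
    then have v: "v \<in> vecs (Q \<tau> {} 0)" by (rule vecs_sub(2)[OF sp cx])
    \<comment> \<open>every value of the augmentation on \<open>Q \<tau> {}\<close> is taken on the subcomplex\<close>
    obtain w where w: "w \<in> vecs (Q (insert x \<tau>) {} 0)" "(\<Sum>c<n 0. e c * w c) = (\<Sum>c<n 0. e c * v c)"
    proof (cases "(\<Sum>c<n 0. e c * v c) = 0")
      case True
      then show ?thesis using that[of "\<lambda>_. 0"] by (simp add: vecs_def)
    next
      case False
      then have "insert x \<tau> \<in> K" using image[of \<tau>] v cone by blast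
      then obtain u where u: "u \<in> vecs (Q (insert x \<tau>) {} 0)" "(\<Sum>c<n 0. e c * u c) \<noteq> 0"
        using image by blast
      let ?s = "(\<Sum>c<n 0. e c * v c) / (\<Sum>c<n 0. e c * u c)"
      have "(\<Sum>c<n 0. e c * (?s * u c)) = ?s * (\<Sum>c<n 0. e c * u c)" by (rule scalar_scale)
      also have "\<dots> = (\<Sum>c<n 0. e c * v c)" using u(2) by simp
      finally show ?thesis using that[of "\<lambda>j. ?s * u j"] u(1) by (simp add: vecs_def)
    qed
    have "(\<Sum>c<n 0. e c * (v - w) c) = 0" using w(2) by (simp add: algebra_simps sum_subtractf)
    moreover have "v - w \<in> vecs (Q \<tau> {} 0)"
      using v vecs_sub(1)[OF sp cx w(1)] by (simp add: vecs_def)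
    ultimately have "v - w \<in> dif a (Q \<tau> {}) 0 ` vecs (Q \<tau> {} 1)" unfolding kernel by simp
    then obtain u where u: "v - w = dif a (Q \<tau> {}) 0 u" by blast
    have "v = restrict (Q \<tau> {x} 0) (v - w)"
      using linear_map_diff[OF linear_restrict, of "Q \<tau> {x} 0" v w] restrict_id[OF sp cx v'']
        restrict_eq_0[OF sp cx vecs_sub(1)[OF sp cx w(1)]] w(1) by (simp add: fun_eq_iff)
    also have "\<dots> = dif a (Q \<tau> {x}) 0 (restrict (Q \<tau> {x} (Suc 0)) u)"
      using dif_quotient[OF sp cx, of 0 u] u by simp
    finally have "v = dif a (Q \<tau> {x}) 0 (restrict (Q \<tau> {x} (Suc 0)) u)" .
    then show "v \<in> dif a (Q \<tau> {x}) 0 ` vecs (Q \<tau> {x} (Suc 0))"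
      by (rule image_eqI[OF _ restrict_in_vecs])
  next
    fix v assume "v \<in> dif a (Q \<tau> {x}) 0 ` vecs (Q \<tau> {x} (Suc 0))"
    then show "v \<in> kcycles a (Q \<tau> {x}) 0" by (auto simp: kcycles_def dif_in_vecs)
  qed
next
  case (Suc m)
  show ?thesis
  proof (rule exact_quotient_if_injective[OF splits_block is_complex_block])
    show "exact_at a (Q \<tau> {}) i" using Suc exact by simp
    fix i' assume i': "i = Suc i'"
    show "\<forall>y\<in>kcycles a (Q (insert x \<tau>) {}) i'. y \<in> dif a (Q \<tau> {}) i' ` vecs (Q \<tau> {} (Suc i')) \<longrightarrow>
        y \<in> dif a (Q (insert x \<tau>) {}) i' ` vecs (Q (insert x \<tau>) {} (Suc i'))"
    proof (cases i')
      case 0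
      then show ?thesis using kernel[of \<tau>] kernel[of "insert x \<tau>"] by (auto simp: kcycles_def)
    next
      case (Suc l)
      then show ?thesis using exact[of i' "insert x \<tau>"] by (auto simp: exact_at_def)
    qed
  qed
qed

theorem exact_if_cone:
  assumes cone: "\<And>\<tau>. \<tau> \<in> K \<Longrightarrow> insert z \<tau> \<in> K"
  shows "exact_at a (Q {} UNIV) i"
proof -
  have "exact_at a (Q \<tau> (insert z T)) i" for T :: "'v set" and \<tau> i
    using finite[of T]
  proof (induction T arbitrary: \<tau> i rule: finite_induct)
    case (insert y T \<tau> i)
    have "exact_at a (Q \<tau> (insert y (insert z T))) i"
      by (rule exact_quotient[OF splits_block is_complex_block]) (rule insert.IH)+
    then show ?case by (simp only: insert_commute)
  qed (rule exact_block_cone_point[OF cone])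
  from this[of "{}" UNIV] show ?thesis by simp
qed

end

section \<open>Homogeneous matrices over the polynomial ring\<close>

abbreviation lookup where "lookup \<equiv> Poly_Mapping.lookup"
abbreviation single where "single \<equiv> Poly_Mapping.single"

definition divides :: "('v \<Rightarrow>\<^sub>0 nat) \<Rightarrow> ('v \<Rightarrow>\<^sub>0 nat) \<Rightarrow> bool" where
  "divides d \<rho> \<longleftrightarrow> (\<forall>x. lookup d x \<le> lookup \<rho> x)"

lemma divides_diff_add: "divides d \<rho> \<Longrightarrow> (\<rho> - d) + d = \<rho>"
  by (rule poly_mapping_eqI) (simp add: lookup_add lookup_minus divides_def)

lemma divides_iff: "divides d \<rho> \<longleftrightarrow> (\<exists>q. q + d = \<rho>)"
proof
  assume "divides d \<rho>" then show "\<exists>q. q + d = \<rho>" using divides_diff_add by blast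
qed (auto simp: divides_def lookup_add)

lemma divides_trans: "divides a b \<Longrightarrow> divides b c \<Longrightarrow> divides a c"
  unfolding divides_def by (meson le_trans)

lemma divides_0 [simp]: "divides 0 \<rho>" by (simp add: divides_def)

lemma lookup_monomial_mult:
  fixes q :: "('v, 'k::comm_ring_1) mpoly"
  shows "lookup (single s a * q) k = (if divides s k then a * lookup q (k - s) else 0)"
proof -
  have "lookup (single s a * q) k = (\<Sum>l. (a when s = l) * (\<Sum>p. lookup q p when k = l + p))"
    by (simp add: lookup_mult lookup_single)
  also have "\<dots> = a * (\<Sum>p. lookup q p when k = s + p)"
    by (simp add: when_mult)
  also have "(\<Sum>p. lookup q p when k = s + p) = (if divides s k then lookup q (k - s) else 0)"
  proof (cases "divides s k")
    case True
    have "(k = s + p) \<longleftrightarrow> (p = k - s)" for p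
      using divides_diff_add[OF True] by (metis add.commute add_diff_cancel_left')
    then show ?thesis using True by simp
  next
    case False
    then have "k \<noteq> s + p" for p by (auto simp: divides_def lookup_add)
    then show ?thesis using False by simp
  qed
  finally show ?thesis by simp
qed

text \<open>
  A homogeneous element of degree \<open>\<rho>\<close> of the free module with basis vectors of degrees \<open>d c\<close> has as its
  \<open>c\<close>-th entry a multiple of the monomial of exponent \<open>\<rho> - d c\<close>. So it is a vector over \<open>\<bbbk>\<close>
  supported on the basis vectors whose degree divides \<open>\<rho>\<close>. The next two functions translate between
  elements of the free module and these vectors.
\<close>

definition component :: "(nat \<Rightarrow> 'v \<Rightarrow>\<^sub>0 nat) \<Rightarrow> nat \<Rightarrow> ('v \<Rightarrow>\<^sub>0 nat) \<Rightarrow> (nat \<Rightarrow> ('v, 'k::field) mpoly) \<Rightarrow> nat \<Rightarrow> 'k" where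
  "component d n \<rho> v = (\<lambda>c. if c < n \<and> divides (d c) \<rho> then lookup (v c) (\<rho> - d c) else 0)"

definition homogeneous :: "(nat \<Rightarrow> 'v \<Rightarrow>\<^sub>0 nat) \<Rightarrow> nat \<Rightarrow> ('v \<Rightarrow>\<^sub>0 nat) \<Rightarrow> (nat \<Rightarrow> 'k::field) \<Rightarrow> nat \<Rightarrow> ('v, 'k) mpoly" where
  "homogeneous d n \<rho> x = (\<lambda>c. if c < n \<and> divides (d c) \<rho> then single (\<rho> - d c) (x c) else 0)"

definition basis_below :: "(nat \<Rightarrow> 'v \<Rightarrow>\<^sub>0 nat) \<Rightarrow> nat \<Rightarrow> ('v \<Rightarrow>\<^sub>0 nat) \<Rightarrow> nat set" where
  "basis_below d n \<rho> = {c. c < n \<and> divides (d c) \<rho>}"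

text \<open>
  An entry of a homogeneous matrix is a multiple of one monomial, and its coefficient is recorded here.
  The same scalar matrix then describes the map in every degree \<open>\<rho>\<close>, restricted to the basis
  vectors below \<open>\<rho>\<close>.
\<close>

definition scalars ::
    "(nat \<Rightarrow> 'v \<Rightarrow>\<^sub>0 nat) \<Rightarrow> (nat \<Rightarrow> 'v \<Rightarrow>\<^sub>0 nat) \<Rightarrow> (nat \<Rightarrow> nat \<Rightarrow> ('v, 'k::field) mpoly) \<Rightarrow> nat \<Rightarrow> nat \<Rightarrow> 'k" where
  "scalars dr dc A = (\<lambda>r c. lookup (A r c) (dc c - dr r))"

definition hom_matrix ::
    "nat \<Rightarrow> nat \<Rightarrow> (nat \<Rightarrow> 'v \<Rightarrow>\<^sub>0 nat) \<Rightarrow> (nat \<Rightarrow> 'v \<Rightarrow>\<^sub>0 nat) \<Rightarrow> (nat \<Rightarrow> nat \<Rightarrow> ('v, 'k::field) mpoly) \<Rightarrow> bool" where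
  "hom_matrix m n dr dc A \<longleftrightarrow> (\<forall>r<m. \<forall>c<n. \<forall>k\<in>Poly_Mapping.keys (A r c). k + dr r = dc c)"

lemma hom_matrix_entry:
  assumes "hom_matrix m n dr dc A" "r < m" "c < n"
  shows "A r c = (if divides (dr r) (dc c) then single (dc c - dr r) (scalars dr dc A r c) else 0)"
proof (rule poly_mapping_eqI)
  fix k
  have *: "k + dr r = dc c" if "lookup (A r c) k \<noteq> 0" for k
    using assms that by (auto simp: hom_matrix_def in_keys_iff)
  show "lookup (A r c) k =
      lookup (if divides (dr r) (dc c) then single (dc c - dr r) (scalars dr dc A r c) else 0) k"
  proof (cases "lookup (A r c) k = 0")
    case True
    then show ?thesis by (simp add: scalars_def lookup_single when_def)
  next
    case False
    from *[OF this] have "divides (dr r) (dc c)" "k = dc c - dr r"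
      by (metis divides_iff, metis add_diff_cancel_right')
    then show ?thesis by (simp add: scalars_def)
  qed
qed

lemma scalars_nonzero:
  assumes "hom_matrix m n dr dc A" "r < m" "c < n" "scalars dr dc A r c \<noteq> 0"
  shows "divides (dr r) (dc c)"
proof (rule ccontr)
  assume "\<not> divides (dr r) (dc c)"
  then have "A r c = 0" using hom_matrix_entry[OF assms(1-3)] by simp
  then show False using assms(4) by (simp add: scalars_def)
qed

lemma component_in_vecs: "component d n \<rho> v \<in> vecs (basis_below d n \<rho>)"
  by (simp add: component_def vecs_def basis_below_def)

lemma homogeneous_in_free_mod: "homogeneous d n \<rho> x \<in> free_mod n"
  by (simp add: homogeneous_def free_mod_def)

lemma mat_apply_in_free_mod: "mat_apply m n A v \<in> free_mod m"
  by (simp add: mat_apply_def free_mod_def)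

lemma component_homogeneous:
  assumes "x \<in> vecs (basis_below d n \<rho>)"
  shows "component d n \<rho>' (homogeneous d n \<rho> x) = (if \<rho>' = \<rho> then x else (\<lambda>_. 0))"
proof -
  have "\<rho> - d c \<noteq> \<rho>' - d c" if "\<rho>' \<noteq> \<rho>" "divides (d c) \<rho>" "divides (d c) \<rho>'" for c
    using divides_diff_add that by metis
  then show ?thesis
    using assms
    by (auto simp: component_def homogeneous_def vecs_def basis_below_def fun_eq_iff lookup_single when_def)
qed

lemma free_mod_eqI:
  assumes "v \<in> free_mod n" "w \<in> free_mod n" "\<And>\<rho>. component d n \<rho> v = component d n \<rho> w"
  shows "v = w"
proof
  fix c show "v c = w c"
  proof (cases "c < n")
    case True
    show ?thesis
    proof (rule poly_mapping_eqI)
      fix k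
      have "divides (d c) (k + d c)" using divides_iff by blast
      then show "lookup (v c) k = lookup (w c) k"
        using fun_cong[OF assms(3)[of "k + d c"], of c] True by (simp add: component_def)
    qed
  qed (use assms(1,2) in \<open>simp add: free_mod_def\<close>)
qed

lemma component_0: "component d n \<rho> (\<lambda>_. 0) = (\<lambda>_. 0)"
  by (simp add: component_def fun_eq_iff)

lemma component_sum: "component d n \<rho> (\<lambda>c. \<Sum>s\<in>R. f s c) = (\<lambda>c. \<Sum>s\<in>R. component d n \<rho> (f s) c)"
  by (auto simp: component_def fun_eq_iff lookup_sum)

lemma component_mat_apply:
  assumes A: "hom_matrix m n dr dc A"
  shows "component dr m \<rho> (mat_apply m n A v) =
    mat_on (basis_below dr m \<rho>) (basis_below dc n \<rho>) (scalars dr dc A) (component dc n \<rho> v)"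
proof
  fix r
  show "component dr m \<rho> (mat_apply m n A v) r =
    mat_on (basis_below dr m \<rho>) (basis_below dc n \<rho>) (scalars dr dc A) (component dc n \<rho> v) r"
  proof (cases "r < m \<and> divides (dr r) \<rho>")
    case True
    have "lookup (A r c * v c) (\<rho> - dr r) = scalars dr dc A r c * component dc n \<rho> v c" if c: "c < n" for c
    proof (cases "divides (dr r) (dc c)")
      case False
      then have "A r c = 0" using hom_matrix_entry[OF A _ c, of r] True by simp
      then show ?thesis by (simp add: scalars_def)
    next
      case dv: True
      have eq: "A r c = single (dc c - dr r) (scalars dr dc A r c)"
        using hom_matrix_entry[OF A _ c, of r] True dv by simp
      have "divides (dc c - dr r) (\<rho> - dr r) \<longleftrightarrow> divides (dc c) \<rho>"
        using dv True unfolding divides_def lookup_minus by (metis diff_le_mono le_diff_iff)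
      moreover have "\<rho> - dr r - (dc c - dr r) = \<rho> - dc c"
        using dv unfolding divides_def by (intro poly_mapping_eqI) (simp add: lookup_minus)
      ultimately show ?thesis
        unfolding component_def by (subst eq) (simp add: lookup_monomial_mult c)
    qed
    then have "component dr m \<rho> (mat_apply m n A v) r =
        (\<Sum>c<n. scalars dr dc A r c * component dc n \<rho> v c)"
      using True by (simp add: component_def mat_apply_def lookup_sum)
    also have "\<dots> = (\<Sum>c\<in>basis_below dc n \<rho>. scalars dr dc A r c * component dc n \<rho> v c)"
      by (rule sum.mono_neutral_right) (auto simp: basis_below_def component_def)
    finally show ?thesis using True by (simp add: mat_on_def basis_below_def)
  qed (auto simp: component_def mat_on_def basis_below_def)
qed

lemma mat_apply_homogeneous:
  assumes "hom_matrix m n dr dc A" "x \<in> vecs (basis_below dc n \<rho>)"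
  shows "mat_apply m n A (homogeneous dc n \<rho> x) =
    homogeneous dr m \<rho> (mat_on (basis_below dr m \<rho>) (basis_below dc n \<rho>) (scalars dr dc A) x)"
proof (rule free_mod_eqI[OF mat_apply_in_free_mod homogeneous_in_free_mod])
  fix \<rho>'
  have mem: "mat_on (basis_below dr m \<rho>) S M y \<in> vecs (basis_below dr m \<rho>)" for S M and y :: "nat \<Rightarrow> 'b"
    by (simp add: mat_on_def vecs_def)
  show "component dr m \<rho>' (mat_apply m n A (homogeneous dc n \<rho> x)) =
    component dr m \<rho>' (homogeneous dr m \<rho>
      (mat_on (basis_below dr m \<rho>) (basis_below dc n \<rho>) (scalars dr dc A) x))"
    unfolding component_mat_apply[OF assms(1)] component_homogeneous[OF assms(2)] component_homogeneous[OF mem]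
    by (auto simp: mat_on_def)
qed

lemma sum_homogeneous_components:
  assumes v: "v \<in> free_mod n"
  shows "\<exists>R. finite R \<and> v = (\<lambda>c. \<Sum>\<rho>\<in>R. homogeneous d n \<rho> (component d n \<rho> v) c)"
proof (intro exI conjI)
  let ?R = "\<Union>c<n. (\<lambda>k. k + d c) ` Poly_Mapping.keys (v c)"
  show fin: "finite ?R" by auto
  have fm: "(\<lambda>c. \<Sum>\<rho>\<in>?R. homogeneous d n \<rho> (component d n \<rho> v) c) \<in> free_mod n"
    by (simp add: free_mod_def homogeneous_def)
  show "v = (\<lambda>c. \<Sum>\<rho>\<in>?R. homogeneous d n \<rho> (component d n \<rho> v) c)"
  proof (rule free_mod_eqI[OF v fm])
    fix \<rho>
    have "component d n \<rho> (\<lambda>c. \<Sum>\<rho>\<in>?R. homogeneous d n \<rho> (component d n \<rho> v) c) =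
        (\<lambda>c. \<Sum>s\<in>?R. if \<rho> = s then component d n s v c else 0)"
      unfolding component_sum component_homogeneous[OF component_in_vecs]
      by (intro ext sum.cong) auto
    also have "\<dots> = (\<lambda>c. if \<rho> \<in> ?R then component d n \<rho> v c else 0)"
      using fin by (simp add: fun_eq_iff)
    also have "\<dots> = component d n \<rho> v"
    proof
      fix c
      have "component d n \<rho> v c = 0" if "\<rho> \<notin> ?R"
      proof (rule ccontr)
        assume "component d n \<rho> v c \<noteq> 0"
        then have c: "c < n" "divides (d c) \<rho>" "\<rho> - d c \<in> Poly_Mapping.keys (v c)"
          by (auto simp: component_def in_keys_iff split: if_splits)
        have "\<rho> \<in> (\<lambda>k. k + d c) ` Poly_Mapping.keys (v c)"
          using divides_diff_add[OF c(2)] c(3) by (intro image_eqI[of _ _ "\<rho> - d c"]) simp_all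
        then have "\<rho> \<in> ?R" using c(1) by blast
        with that show False ..
      qed
      then show "(if \<rho> \<in> ?R then component d n \<rho> v c else 0) = component d n \<rho> v c" by auto
    qed
    finally show "component d n \<rho> v =
      component d n \<rho> (\<lambda>c. \<Sum>\<rho>\<in>?R. homogeneous d n \<rho> (component d n \<rho> v) c)" by simp
  qed
qed

lemma mat_apply_sum: "mat_apply m n A (\<lambda>c. \<Sum>s\<in>R. f s c) = (\<lambda>r. \<Sum>s\<in>R. mat_apply m n A (f s) r)"
  by (auto simp: mat_apply_def fun_eq_iff sum_distrib_left intro: sum.swap)

text \<open>
  An element of a free module is the finite sum of its homogeneous components, and homogeneous matrices
  act on the components separately.
\<close>

theorem exact_iff_exact_in_degrees:
  assumes A: "hom_matrix m n dr dc A" and B: "hom_matrix n p dc de B"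
  shows "{v \<in> free_mod n. mat_apply m n A v = (\<lambda>_. 0)} = mat_apply n p B ` free_mod p \<longleftrightarrow>
    (\<forall>\<rho>. {x \<in> vecs (basis_below dc n \<rho>).
            mat_on (basis_below dr m \<rho>) (basis_below dc n \<rho>) (scalars dr dc A) x = (\<lambda>_. 0)} =
         mat_on (basis_below dc n \<rho>) (basis_below de p \<rho>) (scalars dc de B) ` vecs (basis_below de p \<rho>))"
    (is "?E \<longleftrightarrow> (\<forall>\<rho>. ?D \<rho>)")
proof (intro iffI allI)
  fix \<rho>
  let ?A = "mat_on (basis_below dr m \<rho>) (basis_below dc n \<rho>) (scalars dr dc A)"
  let ?B = "mat_on (basis_below dc n \<rho>) (basis_below de p \<rho>) (scalars dc de B)"
  assume E: ?E
  show "?D \<rho>"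
  proof (intro equalityI subsetI)
    fix x assume x: "x \<in> {x \<in> vecs (basis_below dc n \<rho>). ?A x = (\<lambda>_. 0)}"
    then have "mat_apply m n A (homogeneous dc n \<rho> x) = (\<lambda>_. 0)"
      using mat_apply_homogeneous[OF A, of x \<rho>] by (simp add: homogeneous_def fun_eq_iff)
    then obtain w where w: "w \<in> free_mod p" "homogeneous dc n \<rho> x = mat_apply n p B w"
      using E homogeneous_in_free_mod[of dc n \<rho> x] by blast
    have "x = component dc n \<rho> (homogeneous dc n \<rho> x)"
      using x component_homogeneous[of x dc n \<rho> \<rho>] by simp
    also have "\<dots> = ?B (component de p \<rho> w)" unfolding w(2) component_mat_apply[OF B] ..
    finally show "x \<in> ?B ` vecs (basis_below de p \<rho>)" using component_in_vecs by blast
  next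
    fix x assume "x \<in> ?B ` vecs (basis_below de p \<rho>)"
    then obtain y where y: "y \<in> vecs (basis_below de p \<rho>)" "x = ?B y" by blast
    have x: "x \<in> vecs (basis_below dc n \<rho>)" unfolding y(2) by (simp add: mat_on_def vecs_def)
    have "homogeneous dc n \<rho> x = mat_apply n p B (homogeneous de p \<rho> y)"
      using mat_apply_homogeneous[OF B y(1)] y(2) by simp
    then have "mat_apply m n A (homogeneous dc n \<rho> x) = (\<lambda>_. 0)"
      using E homogeneous_in_free_mod by blast
    then have "?A x = (\<lambda>_. 0)"
      using component_mat_apply[OF A, of \<rho> "homogeneous dc n \<rho> x"] component_homogeneous[OF x, of \<rho>]
      by (simp add: component_0)
    then show "x \<in> {x \<in> vecs (basis_below dc n \<rho>). ?A x = (\<lambda>_. 0)}" using x by simp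
  qed
next
  assume D: "\<forall>\<rho>. ?D \<rho>"
  show ?E
  proof (intro equalityI subsetI)
    fix v assume v: "v \<in> {v \<in> free_mod n. mat_apply m n A v = (\<lambda>_. 0)}"
    obtain R where R: "finite R" "v = (\<lambda>c. \<Sum>\<rho>\<in>R. homogeneous dc n \<rho> (component dc n \<rho> v) c)"
      using sum_homogeneous_components v by blast
    have "\<exists>w. w \<in> free_mod p \<and> mat_apply n p B w = homogeneous dc n \<rho> (component dc n \<rho> v)" for \<rho>
    proof -
      have "mat_on (basis_below dr m \<rho>) (basis_below dc n \<rho>) (scalars dr dc A) (component dc n \<rho> v) = (\<lambda>_. 0)"
        using component_mat_apply[OF A, of \<rho> v] v by (simp add: component_0)
      then obtain y where y: "y \<in> vecs (basis_below de p \<rho>)" "component dc n \<rho> v =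
          mat_on (basis_below dc n \<rho>) (basis_below de p \<rho>) (scalars dc de B) y"
        using D component_in_vecs[of dc n \<rho> v] by blast
      then have "mat_apply n p B (homogeneous de p \<rho> y) = homogeneous dc n \<rho> (component dc n \<rho> v)"
        using mat_apply_homogeneous[OF B y(1)] by simp
      then show ?thesis using homogeneous_in_free_mod by blast
    qed
    then obtain w where w: "\<And>\<rho>. w \<rho> \<in> free_mod p"
        "\<And>\<rho>. mat_apply n p B (w \<rho>) = homogeneous dc n \<rho> (component dc n \<rho> v)" by metis
    have "v = mat_apply n p B (\<lambda>c. \<Sum>\<rho>\<in>R. w \<rho> c)"
      unfolding mat_apply_sum w(2) by (rule R(2))
    moreover have "(\<lambda>c. \<Sum>\<rho>\<in>R. w \<rho> c) \<in> free_mod p" using w(1) by (simp add: free_mod_def)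
    ultimately show "v \<in> mat_apply n p B ` free_mod p" by blast
  next
    fix v assume "v \<in> mat_apply n p B ` free_mod p"
    then obtain w where w: "v = mat_apply n p B w" by blast
    have "mat_apply m n A v = (\<lambda>_. 0)"
    proof (rule free_mod_eqI[OF mat_apply_in_free_mod])
      show "(\<lambda>_. 0) \<in> free_mod m" by (simp add: free_mod_def)
      fix \<rho>
      have "component dc n \<rho> v \<in>
          mat_on (basis_below dc n \<rho>) (basis_below de p \<rho>) (scalars dc de B) ` vecs (basis_below de p \<rho>)"
        unfolding w component_mat_apply[OF B] using component_in_vecs by blast
      then have "mat_on (basis_below dr m \<rho>) (basis_below dc n \<rho>) (scalars dr dc A) (component dc n \<rho> v) = (\<lambda>_. 0)"
        using D by blast
      then show "component dr m \<rho> (mat_apply m n A v) = component dr m \<rho> (\<lambda>_. 0)"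
        unfolding component_mat_apply[OF A] component_0 .
    qed
    then show "v \<in> {v \<in> free_mod n. mat_apply m n A v = (\<lambda>_. 0)}"
      using mat_apply_in_free_mod[of n p B w] w by simp
  qed
qed

section \<open>Tor in the degree of all indeterminates\<close>

lemma lookup_sqfree_degree:
  assumes "finite s"
  shows "lookup (sqfree_degree s) x = (if x \<in> s then 1 else 0)"
  using assms by (simp add: sqfree_degree_def lookup_sum lookup_single when_def)

lemma block_eq_basis_below:
  fixes g :: "nat \<Rightarrow> nat \<Rightarrow> ('v::finite \<Rightarrow>\<^sub>0 nat)"
  shows "block n g \<tau> {} i = basis_below (g i) (n i) (sqfree_degree (- \<tau>))"
  unfolding block_def basis_below_def divides_def by (auto simp: lookup_sqfree_degree) (metis zero_le)

lemma mat_on_cong_vecs: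
  assumes "x \<in> vecs C" "C \<subseteq> {..<n}"
  shows "(\<Sum>c\<in>C. a r c * x c) = (\<Sum>c<n. a r c * x c)"
  using assms by (intro sum.mono_neutral_left) (auto simp: vecs_def)

lemma basis_below_subset: "basis_below d n \<rho> \<subseteq> {..<n}"
  by (auto simp: basis_below_def)

lemma mat_apply_augmentation:
  "mat_apply 1 (rk F 0) (\<lambda>_. aug F) v = (\<lambda>r. if r = 0 then augmentation F v else 0)"
  by (auto simp: mat_apply_def augmentation_def)

context
  fixes F :: "('v::finite, 'k::field) graded_complex" and I :: "('v, 'k) mpoly set"
  assumes F: "graded_free_resolution F I" and I: "\<And>p q. p \<in> I \<Longrightarrow> q * p \<in> I"
begin

abbreviation (input) "below i \<rho> \<equiv> basis_below (gdeg F i) (rk F i) \<rho>"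

definition scalar_diff :: "'k matrices" where
  "scalar_diff = (\<lambda>i. scalars (gdeg F i) (gdeg F (Suc i)) (diff F i))"

definition scalar_aug :: "nat \<Rightarrow> 'k" where
  "scalar_aug c = lookup (aug F c) (gdeg F 0 c)"

lemma hom_diff: "hom_matrix (rk F i) (rk F (Suc i)) (gdeg F i) (gdeg F (Suc i)) (diff F i)"
  using F by (simp add: graded_free_resolution_def homogeneous_maps_def hom_matrix_def)

lemma hom_aug: "hom_matrix 1 (rk F 0) (\<lambda>_. 0) (gdeg F 0) (\<lambda>_. aug F)"
  using F by (simp add: graded_free_resolution_def homogeneous_maps_def hom_matrix_def)

lemma degree_exact:
  "{x \<in> vecs (below (Suc i) \<rho>). mat_on (below i \<rho>) (below (Suc i) \<rho>) (scalar_diff i) x = (\<lambda>_. 0)} =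
     mat_on (below (Suc i) \<rho>) (below (Suc (Suc i)) \<rho>) (scalar_diff (Suc i)) ` vecs (below (Suc (Suc i)) \<rho>)"
proof -
  have "{v \<in> free_mod (rk F (Suc i)). mat_apply (rk F i) (rk F (Suc i)) (diff F i) v = (\<lambda>_. 0)} =
      mat_apply (rk F (Suc i)) (rk F (Suc (Suc i))) (diff F (Suc i)) ` free_mod (rk F (Suc (Suc i)))"
    using F by (simp add: graded_free_resolution_def boundary_def)
  then show ?thesis
    unfolding exact_iff_exact_in_degrees[OF hom_diff hom_diff] scalar_diff_def by blast
qed

lemma scalar_aug_sum:
  assumes "x \<in> vecs (below 0 \<rho>)"
  shows "mat_on (basis_below (\<lambda>_. 0) 1 \<rho>) (below 0 \<rho>) (scalars (\<lambda>_. 0) (gdeg F 0) (\<lambda>_. aug F)) x =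
    (\<lambda>r. if r = 0 then (\<Sum>c<rk F 0. scalar_aug c * x c) else 0)"
  using mat_on_cong_vecs[OF assms basis_below_subset, of "\<lambda>_. scalar_aug"]
  by (auto simp: mat_on_def basis_below_def scalars_def scalar_aug_def)

lemma degree_exact_aug:
  "{x \<in> vecs (below 0 \<rho>). (\<Sum>c<rk F 0. scalar_aug c * x c) = 0} =
     mat_on (below 0 \<rho>) (below (Suc 0) \<rho>) (scalar_diff 0) ` vecs (below (Suc 0) \<rho>)"
proof -
  have "{v \<in> free_mod (rk F 0). mat_apply 1 (rk F 0) (\<lambda>_. aug F) v = (\<lambda>_. 0)} =
      {v \<in> free_mod (rk F 0). augmentation F v = 0}"
    unfolding mat_apply_augmentation by (auto simp: fun_eq_iff)
  also have "\<dots> = mat_apply (rk F 0) (rk F (Suc 0)) (diff F 0) ` free_mod (rk F (Suc 0))"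
    using F by (simp add: graded_free_resolution_def boundary_def)
  finally have "{x \<in> vecs (below 0 \<rho>).
      mat_on (basis_below (\<lambda>_. 0) 1 \<rho>) (below 0 \<rho>) (scalars (\<lambda>_. 0) (gdeg F 0) (\<lambda>_. aug F)) x = (\<lambda>_. 0)} =
      mat_on (below 0 \<rho>) (below (Suc 0) \<rho>) (scalar_diff 0) ` vecs (below (Suc 0) \<rho>)"
    unfolding exact_iff_exact_in_degrees[OF hom_aug hom_diff] scalar_diff_def by blast
  moreover have "(mat_on (basis_below (\<lambda>_. 0) 1 \<rho>) (below 0 \<rho>)
      (scalars (\<lambda>_. 0) (gdeg F 0) (\<lambda>_. aug F)) x = (\<lambda>_. 0)) \<longleftrightarrow>
      (\<Sum>c<rk F 0. scalar_aug c * x c) = 0" if "x \<in> vecs (below 0 \<rho>)" for x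
    unfolding scalar_aug_sum[OF that] by (auto simp: fun_eq_iff)
  ultimately show ?thesis by (auto cong: conj_cong)
qed

text \<open>
  The augmentation maps the part of \<open>F\<^sub>0\<close> of degree \<open>\<rho>\<close> onto the part of the ideal of that degree,
  which is spanned by the monomial of exponent \<open>\<rho>\<close> or zero.
\<close>

lemma monomial_in_ideal_iff:
  "(\<exists>x\<in>vecs (below 0 \<rho>). (\<Sum>c<rk F 0. scalar_aug c * x c) \<noteq> 0) \<longleftrightarrow> single \<rho> 1 \<in> I"
proof
  assume "\<exists>x\<in>vecs (below 0 \<rho>). (\<Sum>c<rk F 0. scalar_aug c * x c) \<noteq> 0"
  then obtain x where x: "x \<in> vecs (below 0 \<rho>)" "(\<Sum>c<rk F 0. scalar_aug c * x c) \<noteq> 0" by blast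
  let ?s = "\<Sum>c<rk F 0. scalar_aug c * x c"
  have "augmentation F (homogeneous (gdeg F 0) (rk F 0) \<rho> x) = single \<rho> ?s"
    using fun_cong[OF mat_apply_homogeneous[OF hom_aug x(1)], of 0]
    unfolding mat_apply_augmentation scalar_aug_sum[OF x(1)] by (simp add: homogeneous_def)
  moreover have "augmentation F ` free_mod (rk F 0) = I"
    using F by (simp add: graded_free_resolution_def)
  ultimately have "single \<rho> ?s \<in> I"
    using homogeneous_in_free_mod[of "gdeg F 0" "rk F 0" \<rho> x] by (metis imageI)
  then have "single 0 (1 / ?s) * single \<rho> ?s \<in> I" by (rule I)
  then show "single \<rho> 1 \<in> I" using x(2) by (simp add: mult_single)
next
  assume "single \<rho> 1 \<in> I"
  then obtain w where w: "single \<rho> 1 = augmentation F w"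
    using F by (auto simp: graded_free_resolution_def)
  let ?x = "component (gdeg F 0) (rk F 0) \<rho> w"
  have "(\<Sum>c<rk F 0. scalar_aug c * ?x c) = component (\<lambda>_. 0) 1 \<rho> (mat_apply 1 (rk F 0) (\<lambda>_. aug F) w) 0"
    using fun_cong[OF component_mat_apply[OF hom_aug], of \<rho> w 0]
    unfolding scalar_aug_sum[OF component_in_vecs] by simp
  also have "\<dots> = 1" unfolding mat_apply_augmentation w[symmetric] by (simp add: component_def)
  finally show "\<exists>x\<in>vecs (below 0 \<rho>). (\<Sum>c<rk F 0. scalar_aug c * x c) \<noteq> 0"
    by (intro bexI[of _ ?x] component_in_vecs) simp
qed

lemma filtered_resolution_of_graded:
  "filtered_resolution (rk F) (gdeg F) scalar_diff scalar_aug {\<tau>. single (sqfree_degree (- \<tau>)) 1 \<in> I}"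
proof
  fix i r c x assume "r < rk F i" "c < rk F (Suc i)" "scalar_diff i r c \<noteq> 0"
  then have "divides (gdeg F i r) (gdeg F (Suc i) c)"
    using scalars_nonzero[OF hom_diff] unfolding scalar_diff_def by blast
  then show "lookup (gdeg F i r) x \<le> lookup (gdeg F (Suc i) c) x" by (simp add: divides_def)
next
  fix \<tau> :: "'v set"
  note bl = block_eq_basis_below[where \<tau>=\<tau>]
  show "is_complex scalar_diff (block (rk F) (gdeg F) \<tau> {})"
    unfolding is_complex_def dif_def bl
  proof (intro conjI allI ballI)
    fix i show "finite (below i (sqfree_degree (- \<tau>)))" by (simp add: basis_below_def)
  next
    fix i and v :: "nat \<Rightarrow> 'k" assume "v \<in> vecs (below (Suc (Suc i)) (sqfree_degree (- \<tau>)))"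
    then show "mat_on (below i (sqfree_degree (- \<tau>))) (below (Suc i) (sqfree_degree (- \<tau>))) (scalar_diff i)
        (mat_on (below (Suc i) (sqfree_degree (- \<tau>))) (below (Suc (Suc i)) (sqfree_degree (- \<tau>)))
          (scalar_diff (Suc i)) v) = (\<lambda>_. 0)"
      using degree_exact[of i "sqfree_degree (- \<tau>)"] by blast
  qed
  show "exact_at scalar_diff (block (rk F) (gdeg F) \<tau> {}) i" if pos: "i > 0" for i
  proof -
    obtain j where j: "i = Suc j" using pos by (cases i) auto
    show ?thesis
      unfolding exact_at_def kcycles_def dif_def bl j
      using degree_exact[of j "sqfree_degree (- \<tau>)"] by simp
  qed
  show "dif scalar_diff (block (rk F) (gdeg F) \<tau> {}) 0 ` vecs (block (rk F) (gdeg F) \<tau> {} 1) =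
      {v \<in> vecs (block (rk F) (gdeg F) \<tau> {} 0). (\<Sum>c<rk F 0. scalar_aug c * v c) = 0}"
    unfolding dif_def bl using degree_exact_aug by simp
  show "(\<exists>v\<in>vecs (block (rk F) (gdeg F) \<tau> {} 0). (\<Sum>c<rk F 0. scalar_aug c * v c) \<noteq> 0) \<longleftrightarrow>
      \<tau> \<in> {\<tau>. single (sqfree_degree (- \<tau>)) 1 \<in> I}"
    unfolding bl mem_Collect_eq by (rule monomial_in_ideal_iff)
qed

text \<open>
  After tensoring with \<open>\<bbbk>\<close> only the entries between basis vectors of equal degree survive. In the
  degree given by all indeterminates they form the block with \<open>T = UNIV\<close>.
\<close>

lemma homology_dim_0_iff:
  "homology_dim F i (sqfree_degree UNIV) = 0 \<longleftrightarrow> exact_at scalar_diff (block (rk F) (gdeg F) {} UNIV) i"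
proof -
  interpret filtered_resolution "rk F" "gdeg F" scalar_diff scalar_aug "{\<tau>. single (sqfree_degree (- \<tau>)) 1 \<in> I}"
    by (rule filtered_resolution_of_graded)
  let ?B = "block (rk F) (gdeg F) {} UNIV"
  have B: "?B i = {j. j < rk F i \<and> gdeg F i j = sqfree_degree UNIV}" for i
    unfolding block_def by (auto simp: poly_mapping_eq_iff lookup_sqfree_degree fun_eq_iff)
  have part: "reduced_part F i (sqfree_degree UNIV) = vecs (?B i)" for i
    unfolding reduced_part_def B by (auto simp: free_mod_def vecs_def not_le) (meson not_le)
  have bd: "reduced_boundary F i v = dif scalar_diff ?B i v" if v: "v \<in> vecs (?B (Suc i))" for i v
  proof
    fix r
    have "lookup (diff F i r c) 0 * v c = (if r \<in> ?B i then scalar_diff i r c * v c else 0)"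
      if "r < rk F i" "c < rk F (Suc i)" for c
    proof (cases "v c = 0")
      case False
      then have c: "gdeg F (Suc i) c = sqfree_degree UNIV" using v by (auto simp: vecs_def B)
      show ?thesis
      proof (cases "gdeg F i r = sqfree_degree UNIV")
        case True
        then show ?thesis using c that by (simp add: scalar_diff_def scalars_def B)
      next
        case False
        have "lookup (diff F i r c) 0 = 0"
        proof (rule ccontr)
          assume "lookup (diff F i r c) 0 \<noteq> 0"
          then have "0 \<in> Poly_Mapping.keys (diff F i r c)" by (simp add: in_keys_iff)
          then have "0 + gdeg F i r = gdeg F (Suc i) c"
            using hom_diff[of i] that unfolding hom_matrix_def by blast
          then show False using False c by simp
        qed
        then show ?thesis using False by (simp add: B)
      qed
    qed simp
    then have "(\<Sum>c<rk F (Suc i). lookup (diff F i r c) 0 * v c) =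
        (if r \<in> ?B i then \<Sum>c<rk F (Suc i). scalar_diff i r c * v c else 0)" if "r < rk F i"
      using that by auto
    moreover have "(\<Sum>c<rk F (Suc i). scalar_diff i r c * v c) = (\<Sum>c\<in>?B (Suc i). scalar_diff i r c * v c)"
      by (rule mat_on_cong_vecs[OF v, symmetric]) (auto simp: block_def)
    ultimately show "reduced_boundary F i v r = dif scalar_diff ?B i v r"
      unfolding reduced_boundary_def mat_apply_def dif_def mat_on_def by (auto simp: B)
  qed
  have cyc: "cycles F i (sqfree_degree UNIV) = kcycles scalar_diff ?B i"
    unfolding cycles_def kcycles_def part using bd by auto
  have bnd: "boundaries F i (sqfree_degree UNIV) = dif scalar_diff ?B i ` vecs (?B (Suc i))"
    unfolding boundaries_def part using bd by auto
  have sub: "dif scalar_diff ?B i ` vecs (?B (Suc i)) \<subseteq> kcycles scalar_diff ?B i"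
    using is_complex_block[of "{}" UNIV] dif_in_vecs by (auto simp: kcycles_def is_complex_def)
  have "fv.subspace (dif scalar_diff ?B i ` vecs (?B (Suc i)))"
    using linear_dif subspace_vecs unfolding linear_map_def by (rule fvp.linear_subspace_image)
  note eq = subspace_eq_of_dim_le[OF this sub _ _]
  show ?thesis
    unfolding homology_dim_def cyc bnd exact_at_def
    using eq[of "?B i"] by (auto simp: kcycles_def B)
qed

end

section \<open>Existence of multigraded resolutions\<close>

text \<open>
  Homogeneous elements of a free module are stored as pairs of a degree and a vector over \<open>\<bbbk>\<close>. A list of
  such columns is a homogeneous matrix, and also a list of basis vectors for the next free module.
\<close>

type_synonym ('v, 'k) columns = "(('v \<Rightarrow>\<^sub>0 nat) \<times> (nat \<Rightarrow> 'k)) list"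

definition cdeg :: "('v, 'k) columns \<Rightarrow> nat \<Rightarrow> ('v \<Rightarrow>\<^sub>0 nat)" where
  "cdeg L c = fst (L ! c)"

definition ccoef :: "('v, 'k) columns \<Rightarrow> nat \<Rightarrow> nat \<Rightarrow> 'k" where
  "ccoef L r c = snd (L ! c) r"

abbreviation cbelow :: "('v, 'k) columns \<Rightarrow> ('v \<Rightarrow>\<^sub>0 nat) \<Rightarrow> nat set" where
  "cbelow L \<rho> \<equiv> basis_below (cdeg L) (length L) \<rho>"

definition syzygies :: "('v, 'k::field) columns \<Rightarrow> ('v \<Rightarrow>\<^sub>0 nat) \<Rightarrow> (nat \<Rightarrow> 'k) set" where
  "syzygies L \<rho> = {x \<in> vecs (cbelow L \<rho>). \<forall>r. (\<Sum>c<length L. ccoef L r c * x c) = 0}"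

definition generates_syzygies :: "('v, 'k::field) columns \<Rightarrow> ('v, 'k) columns \<Rightarrow> bool" where
  "generates_syzygies L' L \<longleftrightarrow>
     (\<forall>c<length L'. snd (L' ! c) \<in> syzygies L (cdeg L' c)) \<and>
     (\<forall>\<rho>. \<forall>x\<in>syzygies L \<rho>. \<exists>y\<in>vecs (cbelow L' \<rho>). \<forall>r. x r = (\<Sum>c<length L'. ccoef L' r c * y c))"

lemma lcm_exists:
  fixes d :: "nat \<Rightarrow> ('v::finite \<Rightarrow>\<^sub>0 nat)"
  assumes "finite J"
  shows "\<exists>\<mu>. (\<forall>c\<in>J. divides (d c) \<mu>) \<and> (\<forall>\<rho>. (\<forall>c\<in>J. divides (d c) \<rho>) \<longrightarrow> divides \<mu> \<rho>)"
proof (intro exI conjI ballI allI impI)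
  let ?f = "\<lambda>x. Max (insert 0 ((\<lambda>c. lookup (d c) x) ` J))"
  let ?\<mu> = "Abs_poly_mapping ?f"
  have mu: "lookup ?\<mu> x = ?f x" for x by (simp add: lookup_Abs_poly_mapping)
  show "divides (d c) ?\<mu>" if "c \<in> J" for c
    unfolding divides_def mu using assms that by (intro allI Max_ge) auto
  show "divides ?\<mu> \<rho>" if "\<forall>c\<in>J. divides (d c) \<rho>" for \<rho>
    unfolding divides_def mu using assms that by (auto simp: divides_def)
qed

text \<open>
  The syzygies of degree \<open>\<rho>\<close> depend only on the set \<open>J\<close> of columns whose degree divides \<open>\<rho>\<close>, and they
  occur already in the degree of the least common multiple of \<open>J\<close>. So it suffices to take a basis in
  the least common multiple of each of the finitely many sets \<open>J\<close>.
\<close>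

lemma generates_syzygies_exists:
  fixes L :: "('v::finite, 'k::field) columns"
  shows "\<exists>L'. generates_syzygies L' L"
proof -
  let ?N = "{..<length L}"
  define Z where "Z J = {x \<in> vecs J. \<forall>r. (\<Sum>c<length L. ccoef L r c * x c) = 0}" for J
  have "\<forall>J. \<exists>C. C \<subseteq> Z J \<and> \<not> fv.dependent C \<and> Z J \<subseteq> fv.span C"
    using fv.basis_exists by metis
  then obtain C where C: "\<And>J. C J \<subseteq> Z J" "\<And>J. \<not> fv.dependent (C J)" "\<And>J. Z J \<subseteq> fv.span (C J)"
    by metis
  have finC: "finite (C J)" if "J \<subseteq> ?N" for J
    using finite_independent_vecs[of J "C J"] C(1,2)[of J] that
    by (auto simp: Z_def finite_subset)
  have "\<forall>J. \<exists>\<mu>. J \<subseteq> ?N \<longrightarrow> (\<forall>c\<in>J. divides (cdeg L c) \<mu>) \<and>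
      (\<forall>\<rho>. (\<forall>c\<in>J. divides (cdeg L c) \<rho>) \<longrightarrow> divides \<mu> \<rho>)"
  proof
    fix J show "\<exists>\<mu>. J \<subseteq> ?N \<longrightarrow> (\<forall>c\<in>J. divides (cdeg L c) \<mu>) \<and>
        (\<forall>\<rho>. (\<forall>c\<in>J. divides (cdeg L c) \<rho>) \<longrightarrow> divides \<mu> \<rho>)"
    proof (cases "J \<subseteq> ?N")
      case True
      then have "finite J" by (rule finite_subset) simp
      from lcm_exists[OF this, of "cdeg L"] show ?thesis by blast
    qed blast
  qed
  then obtain \<mu> where \<mu>: "\<And>J. J \<subseteq> ?N \<Longrightarrow> \<forall>c\<in>J. divides (cdeg L c) (\<mu> J)"
      "\<And>J \<rho>. J \<subseteq> ?N \<Longrightarrow> \<forall>c\<in>J. divides (cdeg L c) \<rho> \<Longrightarrow> divides (\<mu> J) \<rho>"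
    by metis
  define X where "X = (\<Union>J\<in>Pow ?N. Pair (\<mu> J) ` C J)"
  have "finite X" unfolding X_def using finC by auto
  then obtain L' where L': "set L' = X" "distinct L'" using finite_distinct_list by blast
  have sum_L': "(\<Sum>c<length L'. f (L' ! c)) = (\<Sum>z\<in>X. f z)" for f :: "('v \<Rightarrow>\<^sub>0 nat) \<times> (nat \<Rightarrow> 'k) \<Rightarrow> 'k"
    using sum.reindex_bij_betw[OF bij_betw_nth[OF L'(2) refl L'(1)[symmetric]], of f] .
  have "generates_syzygies L' L"
    unfolding generates_syzygies_def
  proof (intro conjI allI impI ballI)
    fix c assume "c < length L'"
    then have "L' ! c \<in> X" using L'(1) nth_mem by blast
    then obtain J where J: "J \<subseteq> ?N" "snd (L' ! c) \<in> C J" "cdeg L' c = \<mu> J"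
      by (auto simp: X_def cdeg_def)
    have "J \<subseteq> cbelow L (\<mu> J)" using \<mu>(1)[OF J(1)] J(1) by (auto simp: basis_below_def)
    then show "snd (L' ! c) \<in> syzygies L (cdeg L' c)"
      using J(2,3) C(1)[of J] by (auto simp: syzygies_def Z_def vecs_def)
  next
    fix \<rho> x assume x: "x \<in> syzygies L \<rho>"
    let ?J = "cbelow L \<rho>"
    have J: "?J \<subseteq> ?N" by (auto simp: basis_below_def)
    have "x \<in> fv.span (C ?J)" using x C(3)[of ?J] by (auto simp: syzygies_def Z_def)
    then obtain u where u: "x = (\<Sum>v\<in>C ?J. (\<lambda>j. u v * v j))"
      unfolding fv.span_finite[OF finC[OF J]] by auto
    define y where "y = (\<lambda>c. if c < length L' \<and> L' ! c \<in> Pair (\<mu> ?J) ` C ?J then u (snd (L' ! c)) else 0)"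
    have "divides (\<mu> ?J) \<rho>" by (rule \<mu>(2)[OF J]) (simp add: basis_below_def)
    then have "y \<in> vecs (cbelow L' \<rho>)" by (auto simp: vecs_def y_def basis_below_def cdeg_def)
    moreover have "x r = (\<Sum>c<length L'. ccoef L' r c * y c)" for r
    proof -
      have "(\<Sum>c<length L'. ccoef L' r c * y c) =
          (\<Sum>c<length L'. if L' ! c \<in> Pair (\<mu> ?J) ` C ?J then snd (L' ! c) r * u (snd (L' ! c)) else 0)"
        by (rule sum.cong) (auto simp: y_def ccoef_def)
      also have "\<dots> = (\<Sum>z\<in>X. if z \<in> Pair (\<mu> ?J) ` C ?J then snd z r * u (snd z) else 0)"
        by (rule sum_L')
      also have "\<dots> = (\<Sum>z\<in>Pair (\<mu> ?J) ` C ?J. snd z r * u (snd z))"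
        using \<open>finite X\<close> J by (intro sum.mono_neutral_cong_right) (auto simp: X_def)
      also have "\<dots> = (\<Sum>v\<in>C ?J. v r * u v)"
        by (subst sum.reindex) (auto simp: inj_on_def)
      also have "\<dots> = x r" unfolding u sum_fun_apply by (simp add: mult.commute)
      finally show ?thesis by simp
    qed
    ultimately show "\<exists>y\<in>vecs (cbelow L' \<rho>). \<forall>r. x r = (\<Sum>c<length L'. ccoef L' r c * y c)" by blast
  qed
  then show ?thesis ..
qed

definition columns_over :: "('v, 'k::field) columns \<Rightarrow> ('v, 'k) columns \<Rightarrow> bool" where
  "columns_over L' L \<longleftrightarrow> (\<forall>c<length L'. snd (L' ! c) \<in> vecs (cbelow L (cdeg L' c)))"

definition poly_matrix :: "('v, 'k::field) columns \<Rightarrow> ('v, 'k) columns \<Rightarrow> nat \<Rightarrow> nat \<Rightarrow> ('v, 'k) mpoly" where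
  "poly_matrix L L' r c =
     (if r < length L \<and> divides (cdeg L r) (cdeg L' c) then single (cdeg L' c - cdeg L r) (ccoef L' r c) else 0)"

lemma hom_poly_matrix: "hom_matrix (length L) (length L') (cdeg L) (cdeg L') (poly_matrix L L')"
  by (auto simp: hom_matrix_def poly_matrix_def divides_diff_add split: if_splits)

lemma scalars_poly_matrix:
  assumes "columns_over L' L" "c < length L'"
  shows "scalars (cdeg L) (cdeg L') (poly_matrix L L') r c = ccoef L' r c"
  using assms by (auto simp: scalars_def poly_matrix_def columns_over_def vecs_def basis_below_def ccoef_def)

lemma mat_on_poly_matrix:
  assumes over: "columns_over L' L" and x: "x \<in> vecs (cbelow L' \<rho>)"
  shows "mat_on (cbelow L \<rho>) (cbelow L' \<rho>) (scalars (cdeg L) (cdeg L') (poly_matrix L L')) x =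
    (\<lambda>r. \<Sum>c<length L'. ccoef L' r c * x c)"
proof
  fix r
  have cut: "(\<Sum>c<length L'. ccoef L' r c * x c) = (\<Sum>c\<in>cbelow L' \<rho>. ccoef L' r c * x c)"
    using x by (intro sum.mono_neutral_right) (auto simp: vecs_def basis_below_def)
  also have "\<dots> = (\<Sum>c\<in>cbelow L' \<rho>. scalars (cdeg L) (cdeg L') (poly_matrix L L') r c * x c)"
    by (intro sum.cong refl) (simp add: scalars_poly_matrix[OF over] basis_below_def)
  finally have eq: "(\<Sum>c\<in>cbelow L' \<rho>. scalars (cdeg L) (cdeg L') (poly_matrix L L') r c * x c) =
      (\<Sum>c<length L'. ccoef L' r c * x c)" by simp
  have "(\<Sum>c\<in>cbelow L' \<rho>. ccoef L' r c * x c) = 0" if "r \<notin> cbelow L \<rho>"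
  proof (rule sum.neutral, rule ballI)
    fix c assume c: "c \<in> cbelow L' \<rho>"
    then have "r \<notin> cbelow L (cdeg L' c)" using that divides_trans by (auto simp: basis_below_def)
    then have "ccoef L' r c = 0"
      using over c by (auto simp: columns_over_def vecs_def ccoef_def basis_below_def)
    then show "ccoef L' r c * x c = 0" by simp
  qed
  then show "mat_on (cbelow L \<rho>) (cbelow L' \<rho>) (scalars (cdeg L) (cdeg L') (poly_matrix L L')) x r =
      (\<Sum>c<length L'. ccoef L' r c * x c)"
    unfolding mat_on_def eq using cut by simp
qed

lemma generates_columns_over: "generates_syzygies L' L \<Longrightarrow> columns_over L' L"
  by (auto simp: generates_syzygies_def columns_over_def syzygies_def)

lemma poly_matrices_exact:
  assumes over: "columns_over L' L" and gen: "generates_syzygies L'' L'"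
  shows "{v \<in> free_mod (length L'). mat_apply (length L) (length L') (poly_matrix L L') v = (\<lambda>_. 0)} =
    mat_apply (length L') (length L'') (poly_matrix L' L'') ` free_mod (length L'')"
  unfolding exact_iff_exact_in_degrees[OF hom_poly_matrix hom_poly_matrix]
proof
  fix \<rho>
  let ?A = "mat_on (cbelow L \<rho>) (cbelow L' \<rho>) (scalars (cdeg L) (cdeg L') (poly_matrix L L'))"
  let ?B = "mat_on (cbelow L' \<rho>) (cbelow L'' \<rho>) (scalars (cdeg L') (cdeg L'') (poly_matrix L' L''))"
  have over': "columns_over L'' L'" using gen by (rule generates_columns_over)
  have "{x \<in> vecs (cbelow L' \<rho>). ?A x = (\<lambda>_. 0)} = syzygies L' \<rho>"
    unfolding syzygies_def by (auto simp: mat_on_poly_matrix[OF over] fun_eq_iff)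
  also have "\<dots> = ?B ` vecs (cbelow L'' \<rho>)"
  proof (intro equalityI subsetI)
    fix x assume "x \<in> syzygies L' \<rho>"
    then obtain y where y: "y \<in> vecs (cbelow L'' \<rho>)" "\<And>r. x r = (\<Sum>c<length L''. ccoef L'' r c * y c)"
      using gen unfolding generates_syzygies_def by blast
    then have "x = ?B y" unfolding mat_on_poly_matrix[OF over' y(1)] by auto
    then show "x \<in> ?B ` vecs (cbelow L'' \<rho>)" using y(1) by blast
  next
    fix x assume "x \<in> ?B ` vecs (cbelow L'' \<rho>)"
    then obtain y where y: "y \<in> vecs (cbelow L'' \<rho>)" "x = ?B y" by blast
    have x: "x = (\<lambda>r. \<Sum>c<length L''. ccoef L'' r c * y c)"
      using y(2) mat_on_poly_matrix[OF over' y(1)] by simp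
    have "x \<in> vecs (cbelow L' \<rho>)" unfolding y(2) by (simp add: mat_on_def vecs_def)
    moreover have "(\<Sum>c<length L'. ccoef L' r c * x c) = 0" for r
    proof -
      have "(\<Sum>c<length L'. ccoef L' r c * x c) =
          (\<Sum>c<length L'. \<Sum>d<length L''. y d * (ccoef L' r c * ccoef L'' c d))"
        unfolding x sum_distrib_left by (intro sum.cong refl) (simp add: algebra_simps)
      also have "\<dots> = (\<Sum>d<length L''. y d * (\<Sum>c<length L'. ccoef L' r c * ccoef L'' c d))"
        unfolding sum_distrib_left by (rule sum.swap)
      also have "\<dots> = 0"
      proof (rule sum.neutral, rule ballI)
        fix d assume "d \<in> {..<length L''}"
        then have "snd (L'' ! d) \<in> syzygies L' (cdeg L'' d)"
          using gen by (simp add: generates_syzygies_def)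
        then have "(\<Sum>c<length L'. ccoef L' r c * ccoef L'' c d) = 0"
          by (simp add: syzygies_def ccoef_def)
        then show "y d * (\<Sum>c<length L'. ccoef L' r c * ccoef L'' c d) = 0" by simp
      qed
      finally show ?thesis .
    qed
    ultimately show "x \<in> syzygies L' \<rho>" by (simp add: syzygies_def)
  qed
  finally show "{x \<in> vecs (cbelow L' \<rho>). ?A x = (\<lambda>_. 0)} = ?B ` vecs (cbelow L'' \<rho>)" .
qed

lemma module_mult: "module ((*) :: 'r::comm_ring_1 \<Rightarrow> 'r \<Rightarrow> 'r)"
  by unfold_locales (auto simp: algebra_simps)

primrec syzygy_columns :: "('v::finite, 'k::field) columns \<Rightarrow> nat \<Rightarrow> ('v, 'k) columns" where
  "syzygy_columns L 0 = L"
| "syzygy_columns L (Suc i) = (SOME L'. generates_syzygies L' (syzygy_columns L i))"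

lemma generates_syzygy_columns: "generates_syzygies (syzygy_columns L (Suc i)) (syzygy_columns L i)"
  unfolding syzygy_columns.simps by (rule someI_ex[OF generates_syzygies_exists])

text \<open>
  Starting from the monomial generators, the columns of each matrix generate the syzygies of the columns
  of the preceding one.
\<close>

theorem graded_free_resolution_exists:
  fixes G :: "('v::finite \<Rightarrow>\<^sub>0 nat) set"
  assumes "finite G"
  shows "\<exists>F. graded_free_resolution F (ideal_gen ((\<lambda>m. single m (1 :: 'k::field)) ` G))"
proof -
  interpret ring_module: module "(*) :: ('v, 'k) mpoly \<Rightarrow> _" by (rule module_mult)
  obtain ms where ms: "set ms = G" using finite_list[OF assms] by blast
  \<comment> \<open>the polynomial ring itself, as the free module of rank one generated in degree \<open>0\<close>\<close>
  define R where "R = [(0, \<lambda>_. 0) :: ('v \<Rightarrow>\<^sub>0 nat) \<times> (nat \<Rightarrow> 'k)]"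
  define M where "M = map (\<lambda>m. (m, (\<lambda>r. if r = (0::nat) then 1 else 0) :: nat \<Rightarrow> 'k)) ms"
  define L where "L = syzygy_columns M"
  define F :: "('v, 'k) graded_complex" where "F = \<lparr>rk = \<lambda>i. length (L i), gdeg = \<lambda>i. cdeg (L i),
      diff = \<lambda>i. poly_matrix (L i) (L (Suc i)), aug = \<lambda>c. single (cdeg (L 0) c) 1\<rparr>"
  have L0: "L 0 = M" by (simp add: L_def)
  have gen: "generates_syzygies (L (Suc i)) (L i)" for i
    unfolding L_def by (rule generates_syzygy_columns)
  have over0: "columns_over (L 0) R"
    by (auto simp: columns_over_def L0 M_def R_def vecs_def basis_below_def cdeg_def)
  have over: "columns_over (L (Suc i)) (L i)" for i using gen by (rule generates_columns_over)
  have aug_eq: "poly_matrix R (L 0) 0 c = single (cdeg (L 0) c) 1" if "c < length (L 0)" for c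
    using that by (simp add: poly_matrix_def R_def cdeg_def ccoef_def L0 M_def)
  have aug: "mat_apply (length R) (length (L 0)) (poly_matrix R (L 0)) v =
      (\<lambda>r. if r = 0 then augmentation F v else 0)" for v
    by (auto simp: mat_apply_def augmentation_def F_def R_def[THEN arg_cong[of _ _ length]] aug_eq)
  have "homogeneous_maps F"
    unfolding homogeneous_maps_def
    by (auto simp: F_def poly_matrix_def divides_diff_add split: if_splits)
  moreover have "augmentation F ` free_mod (rk F 0) = ideal_gen ((\<lambda>m. single m 1) ` G)"
  proof (intro equalityI subsetI)
    fix p assume "p \<in> augmentation F ` free_mod (rk F 0)"
    then obtain v where p: "p = (\<Sum>c<length ms. v c * single (ms ! c) 1)"
      by (auto simp: augmentation_def F_def L0 M_def cdeg_def mult.commute)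
    show "p \<in> ideal_gen ((\<lambda>m. single m 1) ` G)"
      unfolding p ideal_gen_def
      by (intro ring_module.span_sum ring_module.span_scale ring_module.span_base) (auto simp flip: ms)
  next
    have "ring_module.subspace (augmentation F ` free_mod (rk F 0))"
      unfolding ring_module.subspace_def
    proof (intro conjI ballI allI)
      have "augmentation F (\<lambda>_. 0) = 0" "(\<lambda>_. 0) \<in> free_mod (rk F 0)"
        by (auto simp: augmentation_def free_mod_def)
      then show "0 \<in> augmentation F ` free_mod (rk F 0)" by (metis imageI)
      fix p q c assume "p \<in> augmentation F ` free_mod (rk F 0)" "q \<in> augmentation F ` free_mod (rk F 0)"
      then obtain v w where vw: "v \<in> free_mod (rk F 0)" "w \<in> free_mod (rk F 0)"
          "p = augmentation F v" "q = augmentation F w" by blast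
      have "p + q = augmentation F (\<lambda>j. v j + w j)"
        unfolding vw by (simp add: augmentation_def algebra_simps sum.distrib)
      moreover have "(\<lambda>j. v j + w j) \<in> free_mod (rk F 0)" using vw by (simp add: free_mod_def)
      ultimately show "p + q \<in> augmentation F ` free_mod (rk F 0)" by blast
      have "c * p = augmentation F (\<lambda>j. c * v j)"
        unfolding vw augmentation_def sum_distrib_left by (intro sum.cong refl) (simp add: mult.left_commute)
      moreover have "(\<lambda>j. c * v j) \<in> free_mod (rk F 0)" using vw by (simp add: free_mod_def)
      ultimately show "c * p \<in> augmentation F ` free_mod (rk F 0)" by blast
    qed
    moreover have "(\<lambda>m. single m 1) ` G \<subseteq> augmentation F ` free_mod (rk F 0)"
    proof
      fix p :: "('v, 'k) mpoly" assume "p \<in> (\<lambda>m. single m 1) ` G"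
      then obtain j where j: "j < length ms" "p = single (ms ! j) 1"
        by (auto simp: in_set_conv_nth simp flip: ms)
      have "augmentation F (\<lambda>c. if c = j then 1 else 0) = p"
        using j by (simp add: augmentation_def F_def L0 M_def cdeg_def if_distrib cong: if_cong)
      moreover have "(\<lambda>c. if c = j then 1 else 0) \<in> free_mod (rk F 0)"
        using j by (simp add: free_mod_def F_def L0 M_def)
      ultimately show "p \<in> augmentation F ` free_mod (rk F 0)" by blast
    qed
    moreover fix p :: "('v, 'k) mpoly" assume "p \<in> ideal_gen ((\<lambda>m. single m 1) ` G)"
    ultimately show "p \<in> augmentation F ` free_mod (rk F 0)"
      unfolding ideal_gen_def using ring_module.span_minimal by blast
  qed
  moreover have "{v \<in> free_mod (rk F 0). augmentation F v = 0} = boundary F 0 ` free_mod (rk F 1)"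
  proof -
    have "augmentation F v = 0 \<longleftrightarrow> mat_apply (length R) (length (L 0)) (poly_matrix R (L 0)) v = (\<lambda>_. 0)" for v
      unfolding aug by (auto simp: fun_eq_iff)
    then show ?thesis
      using poly_matrices_exact[OF over0 gen[of 0]] by (simp add: F_def boundary_def)
  qed
  moreover have "{v \<in> free_mod (rk F (Suc i)). boundary F i v = (\<lambda>_. 0)} =
      boundary F (Suc i) ` free_mod (rk F (Suc (Suc i)))" for i
    using poly_matrices_exact[OF over gen[of "Suc i"]] by (simp add: F_def boundary_def)
  ultimately have "graded_free_resolution F (ideal_gen ((\<lambda>m. single m 1) ` G))"
    unfolding graded_free_resolution_def by blast
  then show ?thesis ..
qed

section \<open>Betti numbers of a class of partial functions\<close>

lemma sqfree_monom_eq: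
  "finite s \<Longrightarrow> (sqfree_monom s :: ('v, 'k::comm_ring_1) mpoly) = single (sqfree_degree s) 1"
proof (induction s rule: finite_induct)
  case (insert v s)
  have "(sqfree_monom (insert v s) :: ('v, 'k) mpoly) = indet v * sqfree_monom s"
    using insert.hyps by (simp add: sqfree_monom_def)
  moreover have "sqfree_degree (insert v s) = single v 1 + sqfree_degree s"
    using insert.hyps by (simp add: sqfree_degree_def)
  ultimately show ?case by (simp add: insert.IH indet_def mult_single)
qed (simp add: sqfree_monom_def sqfree_degree_def)

lemma monomial_in_monomial_ideal:
  "single \<rho> (1 :: 'k::field) \<in> ideal_gen ((\<lambda>m. single m 1) ` G) \<longleftrightarrow> (\<exists>m\<in>G. divides m \<rho>)"
proof -
  interpret ring_module: module "(*) :: ('a, 'k) mpoly \<Rightarrow> _" by (rule module_mult)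
  let ?P = "{p :: ('a, 'k) mpoly. \<forall>k\<in>Poly_Mapping.keys p. \<exists>m\<in>G. divides m k}"
  show ?thesis
  proof
    have "ring_module.subspace ?P"
      unfolding ring_module.subspace_def
    proof (intro conjI ballI allI)
      fix p q c assume pq: "p \<in> ?P" "q \<in> ?P"
      show "p + q \<in> ?P" using pq Poly_Mapping.keys_add[of p q] by blast
      show "c * p \<in> ?P"
      proof (rule CollectI, rule ballI)
        fix k assume "k \<in> Poly_Mapping.keys (c * p)"
        then obtain a b where ab: "k = a + b" "b \<in> Poly_Mapping.keys p" using keys_mult[of c p] by blast
        then obtain m where "m \<in> G" "divides m b" using pq(1) by blast
        moreover have "divides b k" unfolding ab(1) divides_iff by blast
        ultimately show "\<exists>m\<in>G. divides m k" using divides_trans by blast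
      qed
    qed simp
    moreover have "(\<lambda>m. single m 1) ` G \<subseteq> ?P" by (auto simp: divides_def)
    ultimately have "ideal_gen ((\<lambda>m. single m 1) ` G) \<subseteq> ?P"
      unfolding ideal_gen_def using ring_module.span_minimal by blast
    moreover assume "single \<rho> (1 :: 'k) \<in> ideal_gen ((\<lambda>m. single m 1) ` G)"
    ultimately show "\<exists>m\<in>G. divides m \<rho>" by auto
  next
    assume "\<exists>m\<in>G. divides m \<rho>"
    then obtain m where m: "m \<in> G" "divides m \<rho>" by blast
    have "single \<rho> (1 :: 'k) = single (\<rho> - m) 1 * single m 1"
      using divides_diff_add[OF m(2)] by (simp add: mult_single)
    also have "\<dots> \<in> ideal_gen ((\<lambda>m. single m 1) ` G)"
      unfolding ideal_gen_def using m(1) by (intro ring_module.span_scale ring_module.span_base) auto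
    finally show "single \<rho> (1 :: 'k) \<in> ideal_gen ((\<lambda>m. single m 1) ` G)" .
  qed
qed

text \<open>
  The product of the indeterminates outside \<open>\<tau>\<close> is a multiple of a generator of the canonical ideal
  iff \<open>\<tau>\<close> lies in the graph of a member of the class.
\<close>

definition domain_complex :: "('u \<rightharpoonup> 'a) set \<Rightarrow> ('u \<times> 'a) set set" where
  "domain_complex C = {\<tau>. \<exists>h\<in>C. \<tau> \<subseteq> Map.graph h}"

text \<open>
  The degree of the partial function with empty domain is the product of all indeterminates.
\<close>

lemma betti_vanishing_resolution:
  fixes C :: "('u::finite \<rightharpoonup> 'a::finite) set"
  obtains n g a e where "filtered_resolution n g (a :: 'k::field matrices) e (domain_complex C)"
    "\<And>i. betti TYPE('k) i Map.empty C = 0 \<longleftrightarrow> exact_at a (block n g {} UNIV) i"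
proof -
  let ?G = "{sqfree_degree (graph_compl h) | h. h \<in> C}" and ?I = "canonical_ideal C :: ('u \<times> 'a, 'k) mpoly set"
  interpret ring_module: module "(*) :: ('u \<times> 'a, 'k) mpoly \<Rightarrow> _" by (rule module_mult)
  have "{sqfree_monom (graph_compl h) | h. h \<in> C} = (\<lambda>m. single m (1 :: 'k)) ` ?G"
    by (auto simp: sqfree_monom_eq)
  then have I: "?I = ideal_gen ((\<lambda>m. single m 1) ` ?G)" by (simp add: canonical_ideal_def)
  have "?G \<subseteq> sqfree_degree ` UNIV" by blast
  then have "finite ?G" by (rule finite_subset) simp
  then have "\<exists>F. graded_free_resolution F ?I"
    unfolding I by (rule graded_free_resolution_exists)
  then have F: "graded_free_resolution (SOME F. graded_free_resolution F ?I) ?I" by (rule someI_ex)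
  have scale: "q * p \<in> ?I" if "p \<in> ?I" for p q
    using that unfolding canonical_ideal_def ideal_gen_def by (rule ring_module.span_scale)
  have div: "divides (sqfree_degree s) (sqfree_degree (- \<tau>)) \<longleftrightarrow> s \<subseteq> - \<tau>" for s \<tau> :: "('u \<times> 'a) set"
    by (auto simp: divides_def lookup_sqfree_degree split: if_splits)
  have compl: "graph_compl h \<subseteq> - \<tau> \<longleftrightarrow> \<tau> \<subseteq> Map.graph h" for h :: "'u \<rightharpoonup> 'a" and \<tau>
    unfolding graph_compl_def by blast
  have "(\<exists>m\<in>?G. divides m (sqfree_degree (- \<tau>))) \<longleftrightarrow> (\<exists>h\<in>C. \<tau> \<subseteq> Map.graph h)" for \<tau>
    unfolding compl[symmetric] div[symmetric] by blast
  then have K: "{\<tau>. single (sqfree_degree (- \<tau>)) 1 \<in> ?I} = domain_complex C"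
    unfolding I monomial_in_monomial_ideal domain_complex_def by simp
  show thesis
  proof (rule that[OF filtered_resolution_of_graded[OF F scale, unfolded K]])
    show "betti TYPE('k) i Map.empty C = 0 \<longleftrightarrow>
        exact_at (scalar_diff (SOME F. graded_free_resolution F ?I))
          (block (rk (SOME F. graded_free_resolution F ?I)) (gdeg (SOME F. graded_free_resolution F ?I)) {} UNIV) i" for i
      using homology_dim_0_iff[OF F scale] by (simp add: betti_def tor_dim_def graph_compl_def)
  qed
qed

theorem euler_eq_0_if_betti_vanish:
  assumes "\<And>i. betti TYPE('k::field) i Map.empty C = 0"
  shows "euler (domain_complex C) = 0"
proof -
  obtain n g a e where "filtered_resolution n g (a :: 'k matrices) e (domain_complex C)"
    "\<And>i. betti TYPE('k) i Map.empty C = 0 \<longleftrightarrow> exact_at a (block n g {} UNIV) i"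
    using betti_vanishing_resolution[of C] by blast
  then show ?thesis using assms filtered_resolution.euler_eq_0_if_exact by blast
qed

theorem betti_vanish_if_cone:
  assumes "\<And>\<tau>. \<tau> \<in> domain_complex C \<Longrightarrow> insert x \<tau> \<in> domain_complex C"
  shows "betti TYPE('k::field) i Map.empty C = 0"
proof -
  obtain n g a e where *: "filtered_resolution n g (a :: 'k matrices) e (domain_complex C)"
    "\<And>i. betti TYPE('k) i Map.empty C = 0 \<longleftrightarrow> exact_at a (block n g {} UNIV) i"
    using betti_vanishing_resolution[of C] by blast
  show ?thesis unfolding *(2) by (rule filtered_resolution.exact_if_cone[OF *(1) assms])
qed

section \<open>Polynomial threshold functions\<close>

lemma poly_eval_superset:
  assumes "finite M" "Poly_Mapping.keys p \<subseteq> M"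
  shows "poly_eval p x = (\<Sum>m\<in>M. lookup p m * (\<Prod>v\<in>UNIV. x v ^ lookup m v))"
  unfolding poly_eval_def using assms by (intro sum.mono_neutral_left) (auto simp: in_keys_iff)

lemma cube_eval_add: "cube_eval (p + q) u = cube_eval p u + cube_eval q u"
proof -
  let ?M = "Poly_Mapping.keys p \<union> Poly_Mapping.keys q"
  show ?thesis
    unfolding cube_eval_def
    using poly_eval_superset[of ?M p] poly_eval_superset[of ?M q]
      poly_eval_superset[OF _ Poly_Mapping.keys_add, of p q]
    by (simp add: lookup_add algebra_simps sum.distrib)
qed

lemma keys_const_mult: "Poly_Mapping.keys (single 0 c * p) \<subseteq> Poly_Mapping.keys p"
  for p :: "('v, real) mpoly"
  by (auto simp: in_keys_iff lookup_monomial_mult)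

lemma cube_eval_const_mult: "cube_eval (single 0 c * p) u = c * cube_eval p u"
  unfolding cube_eval_def
  by (subst poly_eval_superset[OF finite_keys keys_const_mult])
    (simp add: lookup_monomial_mult poly_eval_def sum_distrib_left mult.assoc)

lemma cube_eval_const: "cube_eval (single 0 c) u = c"
  unfolding cube_eval_def by (subst poly_eval_superset[of "{0}"]) auto

lemma total_degree_le_add: "total_degree_le k p \<Longrightarrow> total_degree_le k q \<Longrightarrow> total_degree_le k (p + q)"
  unfolding total_degree_le_def using Poly_Mapping.keys_add[of p q] by blast

lemma total_degree_le_const: "total_degree_le k (single 0 c)"
  by (simp add: total_degree_le_def)

lemma total_degree_le_const_mult:
  fixes p :: "('v::finite, real) mpoly"
  shows "total_degree_le k p \<Longrightarrow> total_degree_le k (single 0 c * p)"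
  unfolding total_degree_le_def using keys_const_mult[of c p] by blast

text \<open>
  After multiplication by \<open>f\<close>, agreeing with \<open>f\<close> at a point means being positive there, and weakly
  representing \<open>f\<close> means being nonnegative.
\<close>

definition signed_evaluations :: "nat \<Rightarrow> ('d::finite cube \<Rightarrow> sign) \<Rightarrow> ('d cube \<Rightarrow> real) set" where
  "signed_evaluations k f = {\<phi>. \<exists>p. total_degree_le k p \<and> \<phi> = (\<lambda>u. sign_val (f u) * cube_eval p u)}"

lemma signed_evaluations_combination:
  assumes "\<phi> \<in> signed_evaluations k f" "\<psi> \<in> signed_evaluations k f"
  shows "(\<lambda>u. s * \<phi> u + t * \<psi> u) \<in> signed_evaluations k f"
proof -
  obtain p q where pq: "total_degree_le k p" "total_degree_le k q"
      "\<phi> = (\<lambda>u. sign_val (f u) * cube_eval p u)" "\<psi> = (\<lambda>u. sign_val (f u) * cube_eval q u)"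
    using assms by (auto simp: signed_evaluations_def)
  let ?r = "single 0 s * p + single 0 t * q"
  have "total_degree_le k ?r" using pq by (intro total_degree_le_add total_degree_le_const_mult)
  moreover have "(\<lambda>u. s * \<phi> u + t * \<psi> u) = (\<lambda>u. sign_val (f u) * cube_eval ?r u)"
    unfolding pq cube_eval_add cube_eval_const_mult by (simp add: algebra_simps)
  ultimately show ?thesis unfolding signed_evaluations_def by blast
qed

lemma zero_signed_evaluation: "(\<lambda>_. 0) \<in> signed_evaluations k f"
  unfolding signed_evaluations_def
  by (intro CollectI exI[of _ "single 0 0"]) (simp add: cube_eval_def poly_eval_def total_degree_le_def)

lemma open_convex_signed_evaluations: "open_convex (signed_evaluations k f)"
proof -
  have "(\<lambda>u. \<phi> u + t * (\<psi> u - \<phi> u)) \<in> signed_evaluations k f"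
    if "\<phi> \<in> signed_evaluations k f" "\<psi> \<in> signed_evaluations k f" for \<phi> \<psi> t
    using signed_evaluations_combination[OF that, of "1 - t" t] by (simp add: algebra_simps)
  then show ?thesis unfolding open_convex_def by (auto intro!: exI[of _ 1])
qed

lemma sign_val_mult_pos_iff:
  assumes "y \<noteq> 0"
  shows "sign_val s * y > 0 \<longleftrightarrow> sign_val s = sgn y"
  using assms by (cases s) (auto simp: sgn_if)

lemma sign_val_inject: "sign_val s = sign_val t \<longleftrightarrow> s = t"
  by (cases s; cases t) auto

text \<open>
  A polynomial with the right signs on \<open>\<sigma>\<close> may vanish elsewhere on the cube. Adding a positive constant below
  all its nonzero absolute values removes the zeros without changing a sign.
\<close>

lemma polythr_agrees_iff:
  "(\<exists>g\<in>polythr k. \<forall>u\<in>\<sigma>. g u = f u) \<longleftrightarrow> \<sigma> \<in> positive_sets (signed_evaluations k f) UNIV"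
proof
  assume "\<exists>g\<in>polythr k. \<forall>u\<in>\<sigma>. g u = f u"
  then obtain g p where g: "\<forall>u\<in>\<sigma>. g u = f u" "total_degree_le k p" "\<forall>u. cube_eval p u \<noteq> 0"
      "\<forall>u. sign_val (g u) = sgn (cube_eval p u)" by (auto simp: polythr_def)
  have "\<forall>u\<in>\<sigma>. sign_val (f u) * cube_eval p u > 0"
    using g by (metis sign_val_mult_pos_iff)
  then show "\<sigma> \<in> positive_sets (signed_evaluations k f) UNIV"
    using g(2) by (intro positive_setsI) (auto simp: signed_evaluations_def)
next
  assume "\<sigma> \<in> positive_sets (signed_evaluations k f) UNIV"
  then obtain p where p: "total_degree_le k p" "\<forall>u\<in>\<sigma>. sign_val (f u) * cube_eval p u > 0"
    by (auto simp: positive_sets_def signed_evaluations_def)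
  obtain \<epsilon> where e: "\<epsilon> > 0"
      "\<forall>t. \<bar>t\<bar> < \<epsilon> \<longrightarrow> (\<forall>u\<in>{u. cube_eval p u \<noteq> 0}. \<bar>cube_eval p u\<bar> + t * (-1) > 0)"
    using small_step_positive_on[of "{u. cube_eval p u \<noteq> 0}" "\<lambda>u. \<bar>cube_eval p u\<bar>" "\<lambda>_. -1"] by auto
  define q where "q = p + single 0 (\<epsilon> / 2)"
  have q: "cube_eval q u = cube_eval p u + \<epsilon> / 2" for u
    by (simp add: q_def cube_eval_add cube_eval_const)
  have small: "\<epsilon> / 2 < \<bar>cube_eval p u\<bar>" if "cube_eval p u \<noteq> 0" for u
    using e(1) e(2)[rule_format, of "\<epsilon> / 2" u] that by simp
  have nz: "cube_eval q u \<noteq> 0" for u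
    using small[of u] e(1) by (cases "cube_eval p u = 0") (auto simp: q)
  define g where "g u = (if cube_eval q u > 0 then Plus else Minus)" for u
  have sgn_g: "sign_val (g u) = sgn (cube_eval q u)" for u
    using nz[of u] by (simp add: g_def sgn_if)
  have "g u = f u" if "u \<in> \<sigma>" for u
  proof -
    have pos: "sign_val (f u) * cube_eval p u > 0" using p(2) that by blast
    then have "cube_eval p u \<noteq> 0" by auto
    then have "sgn (cube_eval q u) = sgn (cube_eval p u)"
      using small[of u] e(1) by (auto simp: q sgn_if)
    then show ?thesis
      using pos sign_val_mult_pos_iff[OF \<open>cube_eval p u \<noteq> 0\<close>, of "f u"] sgn_g[of u]
      by (simp flip: sign_val_inject)
  qed
  moreover have "g \<in> polythr k"
    using nz sgn_g total_degree_le_add[OF p(1) total_degree_le_const] unfolding polythr_def q_def by blast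
  ultimately show "\<exists>g\<in>polythr k. \<forall>u\<in>\<sigma>. g u = f u" by blast
qed

lemma domain_complex_box_restrict:
  "domain_complex (box_restrict (polythr k) f) =
     (\<lambda>\<sigma>. (\<lambda>u. (u, f u)) ` \<sigma>) ` positive_sets (signed_evaluations k f) UNIV"
proof -
  have graph: "Map.graph (agreement g f) = (\<lambda>u. (u, f u)) ` {u. g u = f u}" for g
    by (auto simp: Map.graph_def agreement_def split: if_splits)
  show ?thesis
  proof (intro equalityI subsetI)
    fix \<tau> assume "\<tau> \<in> domain_complex (box_restrict (polythr k) f)"
    then obtain g where g: "g \<in> polythr k" "\<tau> \<subseteq> (\<lambda>u. (u, f u)) ` {u. g u = f u}"
      by (auto simp: domain_complex_def box_restrict_def graph)
    then obtain \<sigma> where \<sigma>: "\<sigma> \<subseteq> {u. g u = f u}" "\<tau> = (\<lambda>u. (u, f u)) ` \<sigma>" by (meson subset_imageE)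
    then have "\<sigma> \<in> positive_sets (signed_evaluations k f) UNIV"
      using g(1) unfolding polythr_agrees_iff[symmetric] by blast
    then show "\<tau> \<in> (\<lambda>\<sigma>. (\<lambda>u. (u, f u)) ` \<sigma>) ` positive_sets (signed_evaluations k f) UNIV"
      using \<sigma>(2) by blast
  next
    fix \<tau> assume "\<tau> \<in> (\<lambda>\<sigma>. (\<lambda>u. (u, f u)) ` \<sigma>) ` positive_sets (signed_evaluations k f) UNIV"
    then obtain \<sigma> where "\<tau> = (\<lambda>u. (u, f u)) ` \<sigma>" "\<exists>g\<in>polythr k. \<forall>u\<in>\<sigma>. g u = f u"
      unfolding polythr_agrees_iff by auto
    then obtain g where "\<tau> = (\<lambda>u. (u, f u)) ` \<sigma>" "g \<in> polythr k" "\<forall>u\<in>\<sigma>. g u = f u" by blast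
    then have "\<tau> \<subseteq> Map.graph (agreement g f)" "agreement g f \<in> box_restrict (polythr k) f"
      unfolding graph box_restrict_def by auto
    then show "\<tau> \<in> domain_complex (box_restrict (polythr k) f)"
      unfolding domain_complex_def by blast
  qed
qed

lemma euler_domain_complex_box_restrict:
  "euler (domain_complex (box_restrict (polythr k) f)) = euler (positive_sets (signed_evaluations k f) UNIV)"
proof -
  have inj: "inj (\<lambda>u. (u, f u))" by (simp add: inj_on_def)
  then have "inj_on (\<lambda>\<sigma>. (\<lambda>u. (u, f u)) ` \<sigma>) S" for S by (simp add: inj_on_def inj_image_eq_iff)
  then show ?thesis
    unfolding euler_def domain_complex_box_restrict
    by (simp add: sum.reindex card_image[OF inj_on_subset[OF inj]])
qed

lemma weakly_representable_iff:
  "weakly_representable_by_polythr k f \<longleftrightarrow>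
     (\<exists>\<phi>\<in>signed_evaluations k f. \<phi> \<noteq> (\<lambda>_. 0) \<and> (\<forall>u. \<phi> u \<ge> 0))"
proof -
  have nz: "sign_val s \<noteq> 0" for s by (cases s) auto
  have "weakly_represents (cube_eval p) f \<longleftrightarrow> (\<forall>u. sign_val (f u) * cube_eval p u \<ge> 0)" for p
  proof -
    have "(cube_eval p u \<noteq> 0 \<longrightarrow> sgn (cube_eval p u) = sign_val (f u)) \<longleftrightarrow> sign_val (f u) * cube_eval p u \<ge> 0" for u
      using sign_val_mult_pos_iff[of "cube_eval p u" "f u"] nz[of "f u"]
      by (cases "cube_eval p u = 0") (auto simp: order_le_less)
    then show ?thesis unfolding weakly_represents_def by simp
  qed
  moreover have "(\<lambda>u. sign_val (f u) * cube_eval p u) \<noteq> (\<lambda>_. 0) \<longleftrightarrow> cube_eval p \<noteq> (\<lambda>u. 0)" for p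
    using nz by (auto simp: fun_eq_iff)
  ultimately show ?thesis
    unfolding weakly_representable_by_polythr_def signed_evaluations_def by blast
qed

text \<open>
  A nonzero nonnegative \<open>\<phi>\<close> makes every point \<open>v\<close> with \<open>\<phi> v > 0\<close> the apex of a cone. If there is none,
  every signed evaluation other than zero is positive somewhere, and the nerve is a sphere.
\<close>

theorem corollary3p46:
  fixes k :: nat and f :: "'d::finite cube \<Rightarrow> sign"
  shows "weakly_representable_by_polythr k f \<longleftrightarrow>
           (\<forall>i. betti TYPE('k::field) i Map.empty (box_restrict (polythr k) f) = 0)"
proof
  let ?W = "signed_evaluations k f" and ?K = "domain_complex (box_restrict (polythr k) f)"
  assume "weakly_representable_by_polythr k f"
  then obtain \<phi> where \<phi>: "\<phi> \<in> ?W" "\<phi> \<noteq> (\<lambda>_. 0)" "\<forall>u. \<phi> u \<ge> 0"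
    unfolding weakly_representable_iff by blast
  then obtain v where v: "\<phi> v > 0" by (metis ext less_eq_real_def)
  have "insert (v, f v) \<tau> \<in> ?K" if \<tau>: "\<tau> \<in> ?K" for \<tau>
  proof -
    obtain \<sigma> \<psi> where \<sigma>: "\<tau> = (\<lambda>u. (u, f u)) ` \<sigma>" "\<psi> \<in> ?W" "\<forall>u\<in>\<sigma>. \<psi> u > 0"
      using \<tau> by (auto simp: domain_complex_box_restrict positive_sets_def)
    \<comment> \<open>a large multiple of \<open>\<phi>\<close> makes the value at \<open>v\<close> positive and lowers no other value\<close>
    let ?t = "(\<bar>\<psi> v\<bar> + 1) / \<phi> v"
    have "\<psi> v + ?t * \<phi> v > 0" using v by simp
    moreover have "\<psi> u + ?t * \<phi> u > 0" if "u \<in> \<sigma>" for u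
    proof -
      have "?t \<ge> 0" using v by simp
      then have "?t * \<phi> u \<ge> 0" using \<phi>(3) by (intro mult_nonneg_nonneg) auto
      then show ?thesis using \<sigma>(3) that by (intro add_pos_nonneg) auto
    qed
    moreover have "(\<lambda>u. \<psi> u + ?t * \<phi> u) \<in> ?W"
      using signed_evaluations_combination[OF \<sigma>(2) \<phi>(1), of 1 ?t] by (simp only: mult_1)
    ultimately have "insert v \<sigma> \<in> positive_sets ?W UNIV"
      by (intro positive_setsI[of _ _ "\<lambda>u. \<psi> u + ?t * \<phi> u"]) auto
    then have "(\<lambda>u. (u, f u)) ` insert v \<sigma> \<in> ?K" unfolding domain_complex_box_restrict by (rule imageI)
    then show ?thesis by (simp add: \<sigma>(1))
  qed
  then show "\<forall>i. betti TYPE('k) i Map.empty (box_restrict (polythr k) f) = 0"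
    using betti_vanish_if_cone by blast
next
  let ?W = "signed_evaluations k f"
  assume "\<forall>i. betti TYPE('k) i Map.empty (box_restrict (polythr k) f) = 0"
  then have euler: "euler (positive_sets ?W UNIV) = 0"
    using euler_eq_0_if_betti_vanish[where 'k='k] unfolding euler_domain_complex_box_restrict[symmetric] by blast
  show "weakly_representable_by_polythr k f"
  proof (rule ccontr)
    assume not: "\<not> weakly_representable_by_polythr k f"
    have "\<forall>\<phi>\<in>?W. (\<forall>u\<in>UNIV. \<phi> u \<le> 0) \<longrightarrow> \<phi> = (\<lambda>_. 0)"
    proof (intro ballI impI)
      fix \<phi> assume \<phi>: "\<phi> \<in> ?W" "\<forall>u\<in>UNIV. \<phi> u \<le> 0"
      have "(\<lambda>u. - \<phi> u) \<in> ?W"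
        using signed_evaluations_combination[OF \<phi>(1) \<phi>(1), of "-1" 0] by simp
      moreover have "\<forall>u. - \<phi> u \<ge> 0" using \<phi>(2) by simp
      ultimately have "(\<lambda>u. - \<phi> u) = (\<lambda>_. 0)"
        using not unfolding weakly_representable_iff by meson
      then show "\<phi> = (\<lambda>_. 0)" by (simp add: fun_eq_iff)
    qed
    then have "\<bar>euler (positive_sets ?W UNIV)\<bar> = 1"
      by (intro euler_uncovered_origin open_convex_signed_evaluations zero_signed_evaluation) auto
    then show False using euler by simp
  qed
qed


end
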